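(* Let $\pi=\prod_{j=1}^{m}t_{k_{j}}^{i_{k_{j}}}$ ($m\ge1$) be an element of $S_n$ presented in the standard OGS canonical form, with $k_1<\cdots<k_m$ and $i_{k_{j}}>0$ for every $1\leq j\leq m$. Consider the standard OGS elementary factorization $\pi=\prod_{v=1}^{z(\pi)}\pi^{(v)}$, $\pi^{(v)}=\prod_{j=1}^{m^{(v)}}t_{h^{(v)}_{j}}^{\imath_{j}^{(v)}}$. Then: (1) The standard OGS elementary factorization of $\pi$ is unique, i.e. the parameters $z(\pi)$, $m^{(v)}$ for $1\le v\le z(\pi)$, and $h^{(v)}_j$, $\imath^{(v)}_j$ for $1\le j\le m^{(v)}$ are uniquely determined by the standard OGS canonical form of $\pi$, and: (a) for every $h^{(v)}_{j}$ there is exactly one $j'$ with $1\le j'\le m$ such that $h^{(v)}_{j}=k_{j'}$; (b) if $h^{(v)}_{j}=k_{j'}$ for some $1\leq v\leq z(\pi)$, $1<j<m^{(v)}$ and $1\leq j'\leq m$, then $\imath_{j}^{(v)}=i_{k_{j'}}$; (c) if $h^{(v_{1})}_{j_{1}}=h^{(v_{2})}_{j_{2}}$ with $1\leq v_{1}<v_{2}\leq z(\pi)$, $1\leq j_{1}\leq m^{(v_{1})}$, $1\leq j_{2}\leq m^{(v_{2})}$, then necessarily $v_{1}=v_{2}-1$, $j_{1}=m^{(v_{1})}$, $j_{2}=1$, and $h^{(v_{2}-1)}_{m^{(v_{2}-1)}}=h^{(v_{2})}_{1}=maj(\pi^{(v_{2})})=k_{j'}$ for some $j'$ such that $\imath_{m^{(v_{2}-1)}}^{(v_{2}-1)}+\imath_{1}^{(v_{2})}=i_{k_{j'}}$.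 (2) $norm(\pi)=\prod_{v=1}^{z(\pi)}norm(\pi^{(v)})$ (concatenation of words). (3) For every $1\le r\le n-1$, $$\ell(s_r\cdot \pi) = \begin{cases} \ell(\pi)-1 & \text{if } r=\sum_{j=1}^{m^{(v)}}\imath_{j}^{(v)} \text{ for some } 1\leq v\leq z(\pi), \\ \ell(\pi)+1 & \text{otherwise,} \end{cases}$$ i.e. $des(\pi)=\bigcup_{v=1}^{z(\pi)}des(\pi^{(v)})=\{maj(\pi^{(v)}) : 1\leq v\leq z(\pi)\}$. (4) $$\ell(\pi) = \sum_{v=1}^{z(\pi)}\ell(\pi^{(v)}) = \sum_{v=1}^{z(\pi)}\sum_{j=1}^{m^{(v)}}h^{(v)}_{j}\, \imath_{j}^{(v)}-\sum_{v=1}^{z(\pi)}\left(maj(\pi^{(v)})\right)^{2} = \sum_{x=1}^{m}k_{x}\, i_{k_{x}}-\sum_{v=1}^{z(\pi)}\left(maj(\pi^{(v)})\right)^{2} = \sum_{x=1}^{m}k_{x}\, i_{k_{x}}-\sum_{c\in des(\pi)}c^{2}.$$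
   Context: $S_n$ is the group of permutations of $\{1,\dots,n\}$, with products taken from left to right: $(\pi_1\cdot\pi_2)(i)=\pi_2(\pi_1(i))$. $s_i$ is the transposition $(i,i+1)$, $1\le i\le n-1$; $\ell(\pi)$ is the Coxeter length with respect to $s_1,\dots,s_{n-1}$ (the number of inversions). $des(\pi)=\{1\le i\le n-1: \pi(i)>\pi(i+1)\}$ and $maj(\pi)=\sum_{i\in des(\pi)}i$. For $2\le m\le n$, $t_m=s_1s_2\cdots s_{m-1}$. Every element of $S_n$ has a unique presentation $t_2^{i_2}t_3^{i_3}\cdots t_n^{i_n}$ with $0\le i_k<k$ (the standard OGS canonical form); one often writes only the factors with non-zero exponent. By a theorem of Adin and Roichman, $maj(\pi)$ equals the sum of the exponents in this form. A non-identity element $\prod_{j=1}^m t_{k_j}^{i_{k_j}}$ in this form, with $k_1<\cdots<k_m$ and all $i_{k_j}>0$, is a standard OGS elementary element if $\sum_{j=1}^m i_{k_j}\le k_1$. A standard OGS elementary factorization of $\pi$ is a presentation $\pi=\prod_{v=1}^{z(\pi)}\pi^{(v)}$ as a product of standard OGS elementary elements $\pi^{(v)}=\prod_{j=1}^{m^{(v)}}t_{h^{(v)}_{j}}^{\imath_{j}^{(v)}}$, each written in its standard OGS canonical form ($h^{(v)}_1<\cdots<h^{(v)}_{m^{(v)}}$, $0<\imath^{(v)}_j<h^{(v)}_j$), such that $\sum_{j=1}^{m^{(1)}}\imath_j^{(1)}\le h^{(1)}_1$ and $h^{(v-1)}_{m^{(v-1)}}\le\sum_{j=1}^{m^{(v)}}\imath_j^{(v)}\le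 h^{(v)}_1$ for $2\le v\le z(\pi)$, where $z(\pi)$ is the minimal number of factors for which such a presentation exists. (So $maj(\pi^{(v)})=\sum_j\imath^{(v)}_j$.) $norm(\pi)$ denotes the normal form of $\pi$: the unique reduced word for $\pi$ of the form $\prod_{u=1}^{n-1}\prod_{r=0}^{y_u-1}s_{u-r}$ with $0\le y_u\le u$ (products expanded from left to right in increasing order of the index; empty products are empty words). *)

theory Defs
  imports "HOL-Combinatorics.Permutations"
begin

text \<open>
  Elements of \<open>S\<^sub>n\<close> are the functions \<open>p\<close> with \<open>p permutes {1..n}\<close>.  Products are taken from left
  to right, i.e. the left factor is applied first, opposite to \<open>(\<circ>)\<close>.
\<close>

definition perm_mult :: "(nat \<Rightarrow> nat) \<Rightarrow> (nat \<Rightarrow> nat) \<Rightarrow> (nat \<Rightarrow> nat)"  (infixl "\<cdot>" 70)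
  where "p \<cdot> q = (\<lambda>x. q (p x))"

definition perm_prod :: "(nat \<Rightarrow> nat) list \<Rightarrow> (nat \<Rightarrow> nat)"
  where "perm_prod ps = foldr (\<cdot>) ps id"

definition simple_refl :: "nat \<Rightarrow> (nat \<Rightarrow> nat)"
  where "simple_refl i = transpose i (i + 1)"

text \<open>A word in the Coxeter generators \<open>s\<^sub>i\<close> is the list of the indices of its letters.\<close>

definition word_perm :: "nat list \<Rightarrow> (nat \<Rightarrow> nat)"
  where "word_perm w = perm_prod (map simple_refl w)"

definition is_word_for :: "nat \<Rightarrow> (nat \<Rightarrow> nat) \<Rightarrow> nat list \<Rightarrow> bool"
  where "is_word_for n p w \<longleftrightarrow> set w \<subseteq> {1..n - 1} \<and> word_perm w = p"

definition coxeter_length :: "nat \<Rightarrow> (nat \<Rightarrow> nat) \<Rightarrow> nat"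
  where "coxeter_length n p = (LEAST l. \<exists>w. is_word_for n p w \<and> length w = l)"

definition is_reduced_word_for :: "nat \<Rightarrow> (nat \<Rightarrow> nat) \<Rightarrow> nat list \<Rightarrow> bool"
  where "is_reduced_word_for n p w \<longleftrightarrow> is_word_for n p w \<and> length w = coxeter_length n p"

definition perm_des :: "nat \<Rightarrow> (nat \<Rightarrow> nat) \<Rightarrow> nat set"
  where "perm_des n p = {i \<in> {1..n - 1}. p (i + 1) < p i}"

definition perm_maj :: "nat \<Rightarrow> (nat \<Rightarrow> nat) \<Rightarrow> nat"
  where "perm_maj n p = \<Sum> (perm_des n p)"

text \<open>The word \<open>\<Prod>\<^sub>u \<Prod>\<^sub>r s\<^bsub>u - r\<^esub>\<close> with \<open>1 \<le> u \<le> n - 1\<close> and \<open>0 \<le> r \<le> y u - 1\<close>.\<close>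

definition normal_word :: "nat \<Rightarrow> (nat \<Rightarrow> nat) \<Rightarrow> nat list"
  where "normal_word n y = concat (map (\<lambda>u. map (\<lambda>r. u - r) [0..<y u]) [1..<n])"

definition normal_form :: "nat \<Rightarrow> (nat \<Rightarrow> nat) \<Rightarrow> nat list"
  where "normal_form n p =
    (THE w. is_reduced_word_for n p w \<and> (\<exists>y. (\<forall>u\<in>{1..n - 1}. y u \<le> u) \<and> w = normal_word n y))"

definition ogs_gen :: "nat \<Rightarrow> (nat \<Rightarrow> nat)"
  where "ogs_gen m = word_perm [1..<m]"

text \<open>
  The list \<open>[(k\<^sub>1, i\<^sub>1), \<dots>, (k\<^sub>m, i\<^sub>m)]\<close> stands for the expression
  \<open>t\<^bsub>k\<^sub>1\<^esub>\<^bsup>i\<^sub>1\<^esup> \<cdots> t\<^bsub>k\<^sub>m\<^esub>\<^bsup>i\<^sub>m\<^esup>\<close>.  Canonical forms list only the factors with non-zero exponent, so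
  the identity has the form \<open>[]\<close>.
\<close>

type_synonym ogs_expr = "(nat \<times> nat) list"

definition ogs_value :: "ogs_expr \<Rightarrow> (nat \<Rightarrow> nat)"
  where "ogs_value w = perm_prod (map (\<lambda>(k, i). ogs_gen k ^^ i) w)"

definition ogs_canonical :: "nat \<Rightarrow> ogs_expr \<Rightarrow> bool"
  where "ogs_canonical n w \<longleftrightarrow>
    sorted_wrt (<) (map fst w) \<and> (\<forall>(k, i) \<in> set w. 2 \<le> k \<and> k \<le> n \<and> 0 < i \<and> i < k)"

definition exp_sum :: "ogs_expr \<Rightarrow> nat"
  where "exp_sum w = (\<Sum>j<length w. snd (w ! j))"

definition ogs_elementary :: "nat \<Rightarrow> ogs_expr \<Rightarrow> bool"
  where "ogs_elementary n w \<longleftrightarrow> ogs_canonical n w \<and> w \<noteq> [] \<and> exp_sum w \<le> fst (hd w)"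

text \<open>
  A presentation as required of a factorization, minimality aside.  The upper bounds on the sums of
  exponents are contained in \<^const>\<open>ogs_elementary\<close>.
\<close>

definition elementary_presentation :: "nat \<Rightarrow> (nat \<Rightarrow> nat) \<Rightarrow> ogs_expr list \<Rightarrow> bool"
  where "elementary_presentation n p F \<longleftrightarrow>
    (\<forall>w \<in> set F. ogs_elementary n w) \<and>
    p = perm_prod (map ogs_value F) \<and>
    (\<forall>v. 0 < v \<and> v < length F \<longrightarrow> fst (last (F ! (v - 1))) \<le> exp_sum (F ! v))"

definition elementary_factor_count :: "nat \<Rightarrow> (nat \<Rightarrow> nat) \<Rightarrow> nat"
  where "elementary_factor_count n p = (LEAST z. \<exists>F. elementary_presentation n p F \<and> length F = z)"

definition elementary_factorization :: "nat \<Rightarrow> (nat \<Rightarrow> nat) \<Rightarrow> ogs_expr list \<Rightarrow> bool"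
  where "elementary_factorization n p F \<longleftrightarrow>
    elementary_presentation n p F \<and> length F = elementary_factor_count n p"

end

theory Submission
  imports Defs
begin

text \<open>
  Everything is read off the inversion code (Lehmer code) \<open>c u = card {j. 1 \<le> j \<le> u \<and> \<pi> j > \<pi> (u + 1)}\<close>.
  The permutation of a normal word with exponents \<open>y\<close> has code \<open>y\<close>, and every permutation is the
  permutation of the normal word of its code.  Hence the normal form spells out the code, the length is
  the sum of the code, and \<open>r\<close> is a descent exactly if \<open>c (r - 1) < c r\<close>.

  An elementary expression \<open>f\<close> with exponent sum \<open>M\<close> and largest generator index \<open>K\<close> denotes a permutation
  with the single descent \<open>M\<close>: its code is \<open>0\<close> below \<open>M\<close>, and at \<open>u \<ge> M\<close> it is the sum of the exponents of
  the \<open>t\<^sub>k\<close> with \<open>k > u\<close> (\<open>inv_code_elementary\<close>).  So the code is supported on \<open>{M..<K}\<close>, it is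
  non-increasing there, and it adds up to \<open>\<Sum> k i - M\<^sup>2\<close>.  The inequalities imposed on consecutive factors
  say precisely that these supports are disjoint intervals in increasing order.  Therefore the normal words
  of the factors concatenate to the normal word of the product, and the code of the product is the sum of
  the codes of the factors.

  This sum can rise only at the exponent sums of the factors (\<open>perm_des_chain_subset\<close>), so a presentation
  has at least as many factors as \<open>\<pi>\<close> has descents.  A presentation whose code does rise at each of them is
  minimal, and it is the only minimal one: the descents give the exponent sums, cutting the code of
  \<open>\<pi>\<close> at the descents gives the codes of the factors, and exponent sum and code determine an elementary
  expression (\<open>descent_exact_elementary_factorization\<close>).  Such a presentation is built from the canonical
  form from right to left, by moving as much of each \<open>t\<^sub>k\<^sup>i\<close> as possible into the current first factor
  (\<open>insert_factor_chain\<close>).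

  The construction preserves the total exponent of each \<open>t\<^sub>k\<close>.  In a chain of factors a generator occurs
  either once, or twice at the junction of two neighbouring factors (\<open>chain_shared_generator\<close>); this turns
  the equality of total exponents into the assertions on the individual exponents.
\<close>

section \<open>Left-to-right products and the generators\<close>

lemma perm_mult_apply: "(p \<cdot> q) x = q (p x)"
  by (simp add: perm_mult_def)

lemma perm_mult_assoc: "(p \<cdot> q) \<cdot> r = p \<cdot> (q \<cdot> r)"
  by (simp add: perm_mult_def)

lemma id_perm_mult [simp]: "id \<cdot> p = p" "p \<cdot> id = p" "(\<lambda>x. x) \<cdot> p = p" "p \<cdot> (\<lambda>x. x) = p"
  by (simp_all add: perm_mult_def)

lemma permutes_perm_mult: "p permutes S \<Longrightarrow> q permutes S \<Longrightarrow> p \<cdot> q permutes S"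
  using permutes_compose[of p S q] by (simp add: perm_mult_def comp_def)

lemma perm_prod_simps [simp]: "perm_prod [] = id" "perm_prod (p # ps) = p \<cdot> perm_prod ps"
  by (simp_all add: perm_prod_def)

lemma perm_prod_append: "perm_prod (ps @ qs) = perm_prod ps \<cdot> perm_prod qs"
  by (induction ps) (simp_all add: perm_mult_assoc)

lemma word_perm_simps [simp]:
  "word_perm [] = id" "word_perm (r # w) = simple_refl r \<cdot> word_perm w"
  by (simp_all add: word_perm_def)

lemma word_perm_append: "word_perm (v @ w) = word_perm v \<cdot> word_perm w"
  by (simp add: word_perm_def perm_prod_append)

lemma simple_refl_permutes: "r \<in> {1..n - 1} \<Longrightarrow> simple_refl r permutes {1..n}"
  unfolding simple_refl_def by (rule permutes_swap_id) auto

lemma simple_refl_mult_cancel [simp]: "simple_refl r \<cdot> (simple_refl r \<cdot> p) = p"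
  by (rule ext) (simp add: perm_mult_apply simple_refl_def)

lemma word_perm_permutes: "set w \<subseteq> {1..n - 1} \<Longrightarrow> word_perm w permutes {1..n}"
proof (induction w)
  case Nil
  show ?case unfolding word_perm_simps by (rule permutes_id)
next
  case (Cons r w)
  then have "r \<in> {1..n - 1}" "set w \<subseteq> {1..n - 1}" by simp_all
  then show ?case
    unfolding word_perm_simps by (intro permutes_perm_mult simple_refl_permutes Cons.IH)
qed

lemma ogs_gen_apply:
  "1 \<le> k \<Longrightarrow> ogs_gen k x = (if x = 1 then k else if 2 \<le> x \<and> x \<le> k then x - 1 else x)"
proof (induction k rule: nat_induct_at_least)
  case base
  show ?case by (simp add: ogs_gen_def)
next
  case (Suc k)
  have "ogs_gen (Suc k) = ogs_gen k \<cdot> simple_refl k"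
    using Suc.hyps by (simp add: ogs_gen_def word_perm_append)
  then show ?case
    using Suc by (auto simp: perm_mult_apply simple_refl_def transpose_def)
qed

lemma ogs_gen_power_apply:
  "i \<le> k \<Longrightarrow> (ogs_gen k ^^ i) x =
     (if 1 \<le> x \<and> x \<le> i then k - i + x else if i < x \<and> x \<le> k then x - i else x)"
proof (induction i)
  case 0
  show ?case by simp
next
  case (Suc i)
  define y where "y = (ogs_gen k ^^ i) x"
  have y: "y = (if 1 \<le> x \<and> x \<le> i then k - i + x else if i < x \<and> x \<le> k then x - i else x)"
    unfolding y_def using Suc by simp
  have step: "(ogs_gen k ^^ Suc i) x = (if y = 1 then k else if 2 \<le> y \<and> y \<le> k then y - 1 else y)"
    unfolding funpow.simps comp_apply y_def[symmetric] by (rule ogs_gen_apply) (use Suc.prems in simp)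
  consider "x = 0" | "1 \<le> x" "x \<le> i" | "x = Suc i" | "Suc i < x" "x \<le> k" | "k < x"
    by linarith
  then show ?case
    unfolding step by (cases; use y Suc.prems in \<open>simp; arith?\<close>)
qed

lemma ogs_gen_permutes: "k \<le> n \<Longrightarrow> ogs_gen k permutes {1..n}"
  unfolding ogs_gen_def by (rule word_perm_permutes) auto

lemma funpow_permutes:
  assumes "p permutes S" shows "p ^^ i permutes S"
proof (induction i)
  case 0
  show ?case unfolding funpow.simps by (rule permutes_id)
next
  case (Suc i)
  then show ?case unfolding funpow.simps using assms by (rule permutes_compose)
qed

lemma ogs_value_simps [simp]:
  "ogs_value [] = id" "ogs_value ((k, i) # w) = (ogs_gen k ^^ i) \<cdot> ogs_value w"
  by (simp_all add: ogs_value_def)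

lemma ogs_value_permutes: "\<forall>e \<in> set w. fst e \<le> n \<Longrightarrow> ogs_value w permutes {1..n}"
proof (induction w)
  case Nil
  show ?case unfolding ogs_value_simps by (rule permutes_id)
next
  case (Cons e w)
  obtain k i where e: "e = (k, i)" by (cases e)
  have "k \<le> n" "ogs_value w permutes {1..n}" using Cons e by simp_all
  then show ?case
    unfolding e ogs_value_simps by (intro permutes_perm_mult funpow_permutes ogs_gen_permutes)
qed


section \<open>The inversion code\<close>

text \<open>
  The Lehmer code of \<open>p\<close>, indexed so that its entry at \<open>u\<close> is the exponent \<open>y u\<close> of the normal
  form of \<open>p\<close>.  The sum of all entries is the number of inversions.
\<close>

definition inv_code :: "(nat \<Rightarrow> nat) \<Rightarrow> nat \<Rightarrow> nat"
  where "inv_code p u = card {j \<in> {1..u}. p (Suc u) < p j}"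

definition inversions :: "nat \<Rightarrow> (nat \<Rightarrow> nat) \<Rightarrow> nat"
  where "inversions n p = (\<Sum>u<n. inv_code p u)"

text \<open>
  At a descent \<open>Suc u\<close> everything that exceeds \<open>p (Suc u)\<close> also exceeds the next value, and
  \<open>p (Suc u)\<close> itself is added; at an ascent nothing can be added.
\<close>

lemma inv_code_less_iff:
  assumes "inj p"
  shows "inv_code p u < inv_code p (Suc u) \<longleftrightarrow> p (Suc (Suc u)) < p (Suc u)"
proof (cases "p (Suc (Suc u)) < p (Suc u)")
  case True
  have "insert (Suc u) {j \<in> {1..u}. p (Suc u) < p j}
          \<subseteq> {j \<in> {1..Suc u}. p (Suc (Suc u)) < p j}"
    using True by auto
  then have "card (insert (Suc u) {j \<in> {1..u}. p (Suc u) < p j})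
          \<le> card {j \<in> {1..Suc u}. p (Suc (Suc u)) < p j}"
    by (intro card_mono) auto
  then show ?thesis
    using True by (simp add: inv_code_def)
next
  case False
  then have less: "p (Suc u) < p (Suc (Suc u))"
    using injD[OF assms, of "Suc u" "Suc (Suc u)"] by fastforce
  then have "{j \<in> {1..Suc u}. p (Suc (Suc u)) < p j} \<subseteq> {j \<in> {1..u}. p (Suc u) < p j}"
    by (auto simp: le_Suc_eq)
  then have "inv_code p (Suc u) \<le> inv_code p u"
    unfolding inv_code_def by (intro card_mono) auto
  then show ?thesis
    using False by simp
qed

text \<open>
  If no later value is smaller than \<open>p (Suc u)\<close>, then all smaller values stand to the left of
  position \<open>Suc u\<close>; the remaining positions on the left carry the larger values, which the code
  counts.
\<close>

lemma inv_code_increasing_after: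
  assumes p: "p permutes {1..n}" and u: "u < n"
    and after: "\<And>j. Suc u < j \<Longrightarrow> j \<le> n \<Longrightarrow> p (Suc u) < p j"
  shows "inv_code p u + p (Suc u) = Suc u"
proof -
  let ?v = "p (Suc u)"
  have v: "1 \<le> ?v" "?v \<le> n"
    using permutes_in_image[OF p, of "Suc u"] u by auto
  have "p ` {j \<in> {1..u}. p j < ?v} = {1..<?v}"
  proof
    show "p ` {j \<in> {1..u}. p j < ?v} \<subseteq> {1..<?v}"
    proof
      fix x assume "x \<in> p ` {j \<in> {1..u}. p j < ?v}"
      then obtain j where j: "j \<in> {1..u}" "p j < ?v" "x = p j" by blast
      then have "p j \<in> {1..n}" using permutes_in_image[OF p, of j] u by simp
      with j show "x \<in> {1..<?v}" by simp
    qed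
    show "{1..<?v} \<subseteq> p ` {j \<in> {1..u}. p j < ?v}"
    proof
      fix x assume x: "x \<in> {1..<?v}"
      then have "x \<in> p ` {1..n}" unfolding permutes_image[OF p] using v by simp
      then obtain j where j: "j \<in> {1..n}" "x = p j" by blast
      have "\<not> Suc u < j" using after[of j] j x by auto
      moreover have "j \<noteq> Suc u" using j x by auto
      ultimately have "j \<le> u" by simp
      with j x show "x \<in> p ` {j \<in> {1..u}. p j < ?v}" by auto
    qed
  qed
  moreover have "inj p" using p by (rule permutes_inj)
  ultimately have "card {j \<in> {1..u}. p j < ?v} = ?v - 1"
    using card_image[OF inj_on_subset[OF \<open>inj p\<close> subset_UNIV], of "{j \<in> {1..u}. p j < ?v}"] by simp
  moreover have split: "{1..u} = {j \<in> {1..u}. p j < ?v} \<union> {j \<in> {1..u}. ?v < p j}"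
  proof -
    have "p j \<noteq> ?v" if "j \<in> {1..u}" for j
      using injD[OF \<open>inj p\<close>, of j "Suc u"] that by auto
    then show ?thesis unfolding neq_iff by force
  qed
  have "card {1..u} = card {j \<in> {1..u}. p j < ?v} + card {j \<in> {1..u}. ?v < p j}"
    by (subst split, rule card_Un_disjoint) auto
  ultimately show ?thesis
    using v by (simp add: inv_code_def)
qed

lemma inv_code_mult_increasing:
  assumes q: "q permutes {1..n}" and c: "strict_mono_on {1..n} c" and u: "u < n"
  shows "inv_code (q \<cdot> c) u = inv_code q u"
proof -
  have "c (q (Suc u)) < c (q j) \<longleftrightarrow> q (Suc u) < q j" if "j \<in> {1..u}" for j
    using strict_mono_on_less[OF c] permutes_in_image[OF q] that u by simp
  then show ?thesis
    by (auto simp: inv_code_def perm_mult_apply intro: arg_cong[where f = card])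
qed

text \<open>
  Multiplying by \<open>s\<^sub>r\<close> on the left exchanges the values at the positions \<open>r\<close> and \<open>r + 1\<close>.  At an
  ascent this exchanges the code entries at \<open>r - 1\<close> and \<open>r\<close> and adds one to the latter, because the
  larger value now stands to the left of the smaller one.  All other entries stay, since they compare
  one value with an unchanged set of values.
\<close>

lemma inversions_simple_refl_ascent:
  assumes r: "r \<in> {1..n - 1}" and asc: "p r < p (Suc r)"
  shows "inversions n (simple_refl r \<cdot> p) = Suc (inversions n p)"
proof -
  obtain r' where r': "Suc r' = r" using r by (cases r) auto
  have le: "j \<le> r' \<longleftrightarrow> j < r" for j using r' by auto
  let ?q = "simple_refl r \<cdot> p"
  have q: "?q x = (if x = r then p (Suc r) else if x = Suc r then p r else p x)" for x
    by (simp add: perm_mult_apply simple_refl_def transpose_def)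
  have other: "inv_code ?q u = inv_code p u" if "u \<notin> {r', r}" for u
  proof (cases "u < r'")
    case True
    then have "{j \<in> {1..u}. ?q (Suc u) < ?q j} = {j \<in> {1..u}. p (Suc u) < p j}"
      using r' by (auto simp: q)
    then show ?thesis by (simp add: inv_code_def)
  next
    case False
    with that have u: "r < u" using r' by auto
    have "bij_betw (transpose r (Suc r)) {j \<in> {1..u}. p (Suc u) < p j}
            {j \<in> {1..u}. ?q (Suc u) < ?q j}"
      by (rule bij_betw_byWitness[where f' = "transpose r (Suc r)"])
         (use u r in \<open>auto simp: q transpose_def\<close>)
    then show ?thesis
      unfolding inv_code_def by (rule bij_betw_same_card[symmetric])
  qed
  have "{j \<in> {1..r'}. ?q (Suc r') < ?q j} = {j \<in> {1..r}. p (Suc r) < p j}"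
    unfolding r' using asc by (auto simp: q le le_less[of _ r])
  then have "inv_code ?q r' = inv_code p r" by (simp add: inv_code_def)
  moreover have "inv_code ?q r = Suc (inv_code p r')"
  proof -
    have "{j \<in> {1..r}. ?q (Suc r) < ?q j} = insert r {j \<in> {1..r'}. p (Suc r') < p j}"
      unfolding r' using asc r by (auto simp: q le le_less[of _ r])
    moreover have "r \<notin> {j \<in> {1..r'}. p (Suc r') < p j}" using r' by auto
    ultimately show ?thesis by (simp add: inv_code_def)
  qed
  moreover have "inversions n f = inv_code f r' + inv_code f r + (\<Sum>u\<in>{..<n} - {r', r}. inv_code f u)"
    for f
  proof -
    have "{..<n} = {r', r} \<union> ({..<n} - {r', r})" using r r' by auto
    then have "inversions n f = sum (inv_code f) ({r', r} \<union> ({..<n} - {r', r}))"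
      by (simp add: inversions_def)
    also have "\<dots> = sum (inv_code f) {r', r} + sum (inv_code f) ({..<n} - {r', r})"
      by (rule sum.union_disjoint) auto
    finally show ?thesis using r' by simp
  qed
  moreover have "(\<Sum>u\<in>{..<n} - {r', r}. inv_code ?q u) = (\<Sum>u\<in>{..<n} - {r', r}. inv_code p u)"
    by (rule sum.cong) (use other in auto)
  ultimately show ?thesis by simp
qed

lemma inversions_simple_refl_descent:
  assumes r: "r \<in> {1..n - 1}" and desc: "p (Suc r) < p r"
  shows "Suc (inversions n (simple_refl r \<cdot> p)) = inversions n p"
proof -
  have "(simple_refl r \<cdot> p) r < (simple_refl r \<cdot> p) (Suc r)"
    using desc by (simp add: perm_mult_apply simple_refl_def)
  from inversions_simple_refl_ascent[OF r this] show ?thesis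
    unfolding simple_refl_mult_cancel by simp
qed

lemma inversions_le_length:
  "set w \<subseteq> {1..n - 1} \<Longrightarrow> inversions n (word_perm w) \<le> length w"
proof (induction w)
  case Nil
  show ?case by (auto simp: inversions_def inv_code_def)
next
  case (Cons r w)
  then have r: "r \<in> {1..n - 1}" and IH: "inversions n (word_perm w) \<le> length w" by auto
  have "set w \<subseteq> {1..n - 1}" using Cons.prems by simp
  then have "inj (word_perm w)" by (rule permutes_inj[OF word_perm_permutes])
  from injD[OF this, of r "Suc r"] have "word_perm w r \<noteq> word_perm w (Suc r)" by auto
  then consider "word_perm w r < word_perm w (Suc r)" | "word_perm w (Suc r) < word_perm w r"
    by linarith
  then have "inversions n (simple_refl r \<cdot> word_perm w) \<le> Suc (inversions n (word_perm w))"
  proof cases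
    case 1
    then show ?thesis by (simp only: inversions_simple_refl_ascent[OF r])
  next
    case 2
    from inversions_simple_refl_descent[OF r, of "word_perm w", OF 2] show ?thesis by linarith
  qed
  with IH show ?case unfolding word_perm_simps length_Cons by linarith
qed


section \<open>Normal words\<close>

lemma normal_word_0 [simp]: "normal_word 0 y = []"
  by (simp add: normal_word_def)

lemma normal_word_Suc:
  "y n \<le> n \<Longrightarrow> normal_word (Suc n) y = normal_word n y @ map (\<lambda>r. n - r) [0..<y n]"
  by (cases "n = 0") (simp_all add: normal_word_def)

lemma normal_word_cong: "(\<And>u. u < n \<Longrightarrow> y u = z u) \<Longrightarrow> normal_word n y = normal_word n z"
  unfolding normal_word_def by (intro arg_cong[where f = concat] map_cong) auto

lemma length_normal_word:
  "\<forall>u<n. y u \<le> u \<Longrightarrow> length (normal_word n y) = (\<Sum>u<n. y u)"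
  by (induction n) (simp_all add: normal_word_Suc)

lemma set_normal_word: "\<forall>u<n. y u \<le> u \<Longrightarrow> set (normal_word n y) \<subseteq> {1..n - 1}"
proof
  fix x assume y: "\<forall>u<n. y u \<le> u" and "x \<in> set (normal_word n y)"
  then obtain u r where "1 \<le> u" "u < n" "r < y u" "x = u - r"
    by (auto simp: normal_word_def)
  moreover have "y u \<le> u" using y \<open>u < n\<close> by simp
  ultimately have "1 \<le> x" "x \<le> n - 1" by linarith+
  then show "x \<in> {1..n - 1}" by simp
qed

text \<open>
  One block \<open>s\<^sub>n s\<^bsub>n-1\<^esub> \<cdots> s\<^bsub>n-y+1\<^esub>\<close> of a normal word moves the value \<open>n + 1\<close> down by \<open>y\<close> and shifts the
  values in between up by one.  It is increasing on \<open>{1..n}\<close>, so appending it does not disturb the code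
  entries below \<open>n\<close>, and it sets the entry at \<open>n\<close> to \<open>y\<close>.  Codes and normal words therefore correspond
  to each other, by induction on \<open>n\<close>.
\<close>

lemma word_perm_block:
  "y \<le> n \<Longrightarrow> word_perm (map (\<lambda>r. n - r) [0..<y]) x =
     (if x = Suc n then Suc n - y else if Suc n - y \<le> x \<and> x \<le> n then Suc x else x)"
proof (induction y)
  case 0
  show ?case by simp
next
  case (Suc y)
  define z where "z = word_perm (map (\<lambda>r. n - r) [0..<y]) x"
  have z: "z = (if x = Suc n then Suc n - y else if Suc n - y \<le> x \<and> x \<le> n then Suc x else x)"
    unfolding z_def using Suc by simp
  have step: "word_perm (map (\<lambda>r. n - r) [0..<Suc y]) x = simple_refl (n - y) z"
    by (simp add: word_perm_append perm_mult_apply z_def)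
  consider "x = Suc n" | "x \<le> n" "Suc n - y \<le> x" | "x = n - y" | "x < n - y" | "Suc n < x"
    by linarith
  then show ?case
    unfolding step simple_refl_def transpose_def
    by cases (use z Suc.prems in \<open>simp; arith?\<close>)+
qed

lemma word_perm_block_increasing:
  "y \<le> n \<Longrightarrow> strict_mono_on {1..n} (word_perm (map (\<lambda>r. n - r) [0..<y]))"
  by (intro strict_mono_onI) (auto simp: word_perm_block)

lemma word_perm_block_permutes:
  "y \<le> n \<Longrightarrow> word_perm (map (\<lambda>r. n - r) [0..<y]) permutes {1..Suc n}"
  by (rule word_perm_permutes) auto

lemma inv_code_word_perm_normal_word:
  assumes "\<forall>u<n. y u \<le> u" "u < n"
  shows "inv_code (word_perm (normal_word n y)) u = y u"
  using assms
proof (induction n)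
  case (Suc n)
  let ?q = "word_perm (normal_word n y)"
  let ?c = "word_perm (map (\<lambda>r. n - r) [0..<y n])"
  have yn: "y n \<le> n" using Suc.prems by simp
  have q: "?q permutes {1..n}"
    using Suc.prems by (intro word_perm_permutes set_normal_word) simp
  have c: "?c permutes {1..Suc n}" using yn by (rule word_perm_block_permutes)
  have prod: "word_perm (normal_word (Suc n) y) = ?q \<cdot> ?c"
    by (simp add: normal_word_Suc[of y, OF yn] word_perm_append)
  show ?case
  proof (cases "u = n")
    case True
    have "?q permutes {1..Suc n}"
      using q by (rule permutes_subset) auto
    then have "?q \<cdot> ?c permutes {1..Suc n}" using c by (rule permutes_perm_mult)
    then have "inv_code (?q \<cdot> ?c) n + (?q \<cdot> ?c) (Suc n) = Suc n"
      by (rule inv_code_increasing_after) auto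
    moreover have "?q (Suc n) = Suc n" using permutes_not_in[OF q] by simp
    then have "(?q \<cdot> ?c) (Suc n) = Suc n - y n"
      by (simp only: perm_mult_apply word_perm_block[OF yn] simp_thms if_True)
    ultimately have "inv_code (?q \<cdot> ?c) n = y n" using yn by linarith
    then show ?thesis unfolding prod True .
  next
    case False
    then show ?thesis
      unfolding prod using Suc inv_code_mult_increasing[OF q word_perm_block_increasing[OF yn], of u]
      by simp
  qed
qed simp

text \<open>
  The last value \<open>p (n + 1)\<close> determines the last code entry; removing the corresponding block leaves a
  permutation of \<open>{1..n}\<close> with the same code below \<open>n\<close>.
\<close>

lemma word_perm_normal_word_inv_code:
  assumes "p permutes {1..n}"
  shows "word_perm (normal_word n (inv_code p)) = p"
  using assms
proof (induction n arbitrary: p)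
  case 0
  then have "p = id" by (simp only: permutes_empty atLeastatMost_empty zero_less_one)
  then show ?case by (simp only: normal_word_0 word_perm_simps)
next
  case (Suc n)
  let ?y = "inv_code p n"
  let ?c = "word_perm (map (\<lambda>r. n - r) [0..<?y])"
  have last: "?y + p (Suc n) = Suc n"
    using Suc.prems by (rule inv_code_increasing_after) auto
  moreover have "1 \<le> p (Suc n)"
    using permutes_in_image[OF Suc.prems, of "Suc n"] by simp
  ultimately have yn: "?y \<le> n" by simp
  have c: "?c permutes {1..Suc n}" using yn by (rule word_perm_block_permutes)
  define q where "q = inv ?c \<circ> p"
  have prod: "q \<cdot> ?c = p"
    by (rule ext) (simp only: q_def perm_mult_apply comp_apply permutes_inverses[OF c])
  have fix_last: "q (Suc n) = Suc n"
  proof -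
    have "?c (Suc n) = Suc n - ?y" by (simp only: word_perm_block[OF yn] simp_thms if_True)
    also have "\<dots> = p (Suc n)" using last by linarith
    finally have "inv ?c (p (Suc n)) = Suc n" by (rule iffD2[OF permutes_inv_eq[OF c]])
    then show ?thesis by (simp only: q_def comp_apply)
  qed
  have "q permutes {1..Suc n}"
    unfolding q_def using Suc.prems permutes_inv[OF c] by (rule permutes_compose)
  then have q: "q permutes {1..n}"
  proof (rule permutes_superset)
    fix x assume "x \<in> {1..Suc n} - {1..n}"
    then have "x = Suc n" by auto
    with fix_last show "q x = x" by simp
  qed
  have "inv_code p u = inv_code q u" if "u < n" for u
    using inv_code_mult_increasing[OF q word_perm_block_increasing[OF yn] that] unfolding prod .
  then have eq: "normal_word n (inv_code p) = normal_word n (inv_code q)"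
    by (rule normal_word_cong)
  show ?case
    unfolding normal_word_Suc[of "inv_code p", OF yn] word_perm_append eq Suc.IH[OF q] by (rule prod)
qed

lemma inv_code_le: "inv_code p u \<le> u"
proof -
  have "card {j \<in> {1..u}. p (Suc u) < p j} \<le> card {1..u}" by (rule card_mono) auto
  then show ?thesis by (simp add: inv_code_def)
qed

text \<open>
  A letter changes the number of inversions by one, so no word is shorter than that number; the normal
  word of the code attains it.
\<close>

lemma coxeter_length_eq_inversions:
  assumes "p permutes {1..n}"
  shows "coxeter_length n p = inversions n p"
  unfolding coxeter_length_def
proof (rule Least_equality)
  let ?w = "normal_word n (inv_code p)"
  have "is_word_for n p ?w"
    unfolding is_word_for_def
    using assms word_perm_normal_word_inv_code set_normal_word inv_code_le by auto
  moreover have "length ?w = inversions n p"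
    by (simp add: length_normal_word inv_code_le inversions_def)
  ultimately show "\<exists>w. is_word_for n p w \<and> length w = inversions n p" by blast
next
  fix l assume "\<exists>w. is_word_for n p w \<and> length w = l"
  then show "inversions n p \<le> l"
    using inversions_le_length by (auto simp: is_word_for_def)
qed

lemma normal_form_eq:
  assumes p: "p permutes {1..n}"
  shows "normal_form n p = normal_word n (inv_code p)"
  unfolding normal_form_def
proof (rule the_equality)
  let ?w = "normal_word n (inv_code p)"
  have "is_word_for n p ?w"
    unfolding is_word_for_def
    using p word_perm_normal_word_inv_code set_normal_word inv_code_le by auto
  moreover have "length ?w = coxeter_length n p"
    by (simp add: length_normal_word inv_code_le inversions_def coxeter_length_eq_inversions[OF p])
  ultimately show "is_reduced_word_for n p ?w \<and>
      (\<exists>y. (\<forall>u\<in>{1..n - 1}. y u \<le> u) \<and> ?w = normal_word n y)"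
    using inv_code_le by (auto simp: is_reduced_word_for_def)
next
  fix w
  assume "is_reduced_word_for n p w \<and> (\<exists>y. (\<forall>u\<in>{1..n - 1}. y u \<le> u) \<and> w = normal_word n y)"
  then obtain y where y: "\<forall>u\<in>{1..n - 1}. y u \<le> u" "w = normal_word n y" "word_perm w = p"
    by (auto simp: is_reduced_word_for_def is_word_for_def)
  \<comment> \<open>The bounds \<open>y u \<le> u\<close> are given for \<open>u \<ge> 1\<close>; resetting \<open>y 0\<close> extends them to \<open>u = 0\<close> and leaves
     the word unchanged.\<close>
  let ?y = "y(0 := 0)"
  have w: "w = normal_word n ?y"
    unfolding y(2) normal_word_def by (intro arg_cong[where f = concat] map_cong) auto
  have "\<forall>u<n. ?y u \<le> u" using y(1) by auto
  then have "inv_code p u = ?y u" if "u < n" for u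
    using inv_code_word_perm_normal_word[of n ?y u] w y(3) that by simp
  then show "w = normal_word n (inv_code p)"
    unfolding w by (intro normal_word_cong) simp
qed

lemma perm_des_iff_inv_code:
  assumes "p permutes {1..n}"
  shows "r \<in> perm_des n p \<longleftrightarrow> r \<in> {1..n - 1} \<and> inv_code p (r - 1) < inv_code p r"
  using inv_code_less_iff[OF permutes_inj[OF assms], of "r - 1"]
  by (cases r) (auto simp: perm_des_def)

text \<open>
  Normal words with separated supports can be concatenated.  This is what makes normal forms
  multiplicative along an elementary factorization.
\<close>

lemma normal_word_add:
  assumes "\<forall>u\<ge>m. y u = 0" "\<forall>u<m. z u = 0" "\<forall>u<n. y u \<le> u" "\<forall>u<n. z u \<le> u"
  shows "normal_word n (\<lambda>u. y u + z u) = normal_word n y @ normal_word n z"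
  using assms(3,4)
proof (induction n)
  case (Suc n)
  have le: "y n \<le> n" "z n \<le> n" "y n + z n \<le> n"
    using Suc.prems assms(1,2) by (cases "n < m"; simp)+
  have IH: "normal_word n (\<lambda>u. y u + z u) = normal_word n y @ normal_word n z"
    using Suc by simp
  show ?case
  proof (cases "n < m")
    case True
    then have "normal_word n z = normal_word n (\<lambda>u. 0)"
      using assms(2) by (intro normal_word_cong) simp
    also have "\<dots> = []" by (simp add: normal_word_def)
    finally have "normal_word n z = []" .
    then show ?thesis
      using True assms(2) IH by (simp add: normal_word_Suc le)
  next
    case False
    then show ?thesis
      using assms(1) IH by (simp add: normal_word_Suc le)
  qed
qed simp


section \<open>Elementary expressions\<close>

text \<open>
  As a function of \<open>u\<close> this is the tail of the exponent sequence; it turns out to be the code of an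
  elementary expression from its descent on.
\<close>

definition exp_above :: "ogs_expr \<Rightarrow> nat \<Rightarrow> nat"
  where "exp_above w u = sum_list (map snd (filter (\<lambda>e. u < fst e) w))"

definition exp_at :: "ogs_expr \<Rightarrow> nat \<Rightarrow> nat"
  where "exp_at w k = sum_list (map snd (filter (\<lambda>e. fst e = k) w))"

lemma exp_above_simps [simp]:
  "exp_above [] u = 0"
  "exp_above (e # w) u = (if u < fst e then snd e else 0) + exp_above w u"
  by (simp_all add: exp_above_def)

lemma exp_at_simps [simp]:
  "exp_at [] k = 0"
  "exp_at (e # w) k = (if fst e = k then snd e else 0) + exp_at w k"
  "exp_at (v @ w) k = exp_at v k + exp_at w k"
  by (simp_all add: exp_at_def)

lemma exp_sum_conv: "exp_sum w = sum_list (map snd w)"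
  by (simp add: exp_sum_def sum_list_sum_nth atLeast0LessThan)

lemma exp_sum_simps [simp]: "exp_sum [] = 0" "exp_sum (e # w) = snd e + exp_sum w"
  by (simp_all add: exp_sum_conv)

lemma exp_above_le_exp_sum: "exp_above w u \<le> exp_sum w"
  by (induction w) auto

lemma exp_above_antimono: "u \<le> v \<Longrightarrow> exp_above w v \<le> exp_above w u"
  by (induction w) auto

lemma exp_above_eq_exp_sum: "\<forall>e\<in>set w. u < fst e \<Longrightarrow> exp_above w u = exp_sum w"
  by (induction w) auto

lemma exp_above_eq_0: "\<forall>e\<in>set w. fst e \<le> u \<Longrightarrow> exp_above w u = 0"
  by (induction w) auto

lemma exp_above_step: "exp_above w u = exp_at w (Suc u) + exp_above w (Suc u)"
  by (induction w) auto

lemma exp_sum_split: "\<forall>e\<in>set w. m \<le> fst e \<Longrightarrow> exp_sum w = exp_at w m + exp_above w m"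
  by (induction w) auto

lemma exp_at_eq_0: "\<forall>e\<in>set w. fst e \<noteq> k \<Longrightarrow> exp_at w k = 0"
  by (induction w) auto

lemma ogs_elementaryD:
  assumes "ogs_elementary n f"
  shows "f \<noteq> []" "sorted_wrt (<) (map fst f)"
    "\<And>e. e \<in> set f \<Longrightarrow> 2 \<le> fst e \<and> fst e \<le> n \<and> 0 < snd e \<and> snd e < fst e"
    "\<And>e. e \<in> set f \<Longrightarrow> exp_sum f \<le> fst e"
    "\<And>e. e \<in> set f \<Longrightarrow> fst e \<le> fst (last f)"
    "\<And>e. e \<in> set f \<Longrightarrow> fst (hd f) \<le> fst e"
    "0 < exp_sum f"
proof -
  show ne: "f \<noteq> []" and sorted: "sorted_wrt (<) (map fst f)"
    using assms by (simp_all add: ogs_elementary_def ogs_canonical_def)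
  show bounds: "2 \<le> fst e \<and> fst e \<le> n \<and> 0 < snd e \<and> snd e < fst e" if "e \<in> set f" for e
    using assms that by (cases e) (auto simp: ogs_elementary_def ogs_canonical_def)
  show hd: "fst (hd f) \<le> fst e" if "e \<in> set f" for e
    using that sorted ne by (cases f) auto
  then show "exp_sum f \<le> fst e" if "e \<in> set f" for e
    using assms that by (fastforce simp: ogs_elementary_def)
  show "fst e \<le> fst (last f)" if "e \<in> set f" for e
    using that sorted ne by (cases f rule: rev_cases) (auto simp: sorted_wrt_append)
  show "0 < exp_sum f"
    using bounds ne by (cases f) auto
qed

lemma exp_sum_less_last:
  assumes "ogs_elementary n f" shows "exp_sum f < fst (last f)"
proof (rule ccontr)
  assume "\<not> ?thesis"
  then have "fst (last f) \<le> fst (hd f)"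
    using ogs_elementaryD(1)[OF assms] ogs_elementaryD(4)[OF assms, of "hd f"] by simp
  moreover obtain e g where f: "f = e # g"
    using ogs_elementaryD(1)[OF assms] by (cases f) auto
  ultimately have "g = []"
    using ogs_elementaryD(2)[OF assms] by (cases g rule: rev_cases) auto
  with f \<open>\<not> ?thesis\<close> ogs_elementaryD(3)[OF assms, of e] show False by simp
qed

text \<open>
  The one-line notation of an elementary element with exponent sum \<open>M\<close>.  Its first \<open>M\<close> positions fall
  into blocks of lengths \<open>i\<^sub>1, \<dots>, i\<^sub>m\<close>, and the \<open>j\<close>-th block is shifted up by \<open>k\<^sub>j - M\<close>; hence the values
  there increase.  The other values keep their order, and the one at position \<open>u + 1\<close> moves down by the
  number of those first positions that are shifted past it.

  Instead of the exact values on the first \<open>M\<close> positions, the induction carries the lower bound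
  \<open>k\<^sub>1 - M\<close>.  It is what compares the block of \<open>t\<^bsub>k\<^sub>1\<^esub>\<close> with the later blocks.  The bound is stated for every
  \<open>K\<close> that exceeds no generator index, so that it makes sense for the empty expression.
\<close>

lemma elementary_one_line:
  assumes "sorted_wrt (<) (map fst w)" "\<forall>e\<in>set w. exp_sum w \<le> fst e"
  shows "(\<forall>u\<ge>exp_sum w. ogs_value w (Suc u) = Suc u - exp_above w u) \<and>
    (\<forall>x\<in>{1..exp_sum w}. \<forall>K. (\<forall>e\<in>set w. K \<le> fst e) \<longrightarrow> K < ogs_value w x + exp_sum w) \<and>
    strict_mono_on {1..exp_sum w} (ogs_value w)"
  using assms
proof (induction w)
  case Nil
  show ?case by (auto intro: strict_mono_onI)
next
  case (Cons e w)
  obtain k i where e: "e = (k, i)" by (cases e)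
  let ?M = "exp_sum (e # w)" and ?M' = "exp_sum w"
  let ?p = "ogs_value (e # w)" and ?q = "ogs_value w"
  have M: "?M = i + ?M'" by (simp add: e)
  have Mk: "?M \<le> k" and ik: "i \<le> k" using Cons.prems by (auto simp: e)
  have above_k: "\<forall>e'\<in>set w. k < fst e'" using Cons.prems by (simp add: e)
  have prems: "sorted_wrt (<) (map fst w)" "\<forall>e\<in>set w. ?M' \<le> fst e"
    using Cons.prems by auto
  note IH = Cons.IH[OF prems]
  have tail: "?q (Suc u) = Suc u - exp_above w u" if "?M' \<le> u" for u using IH that by blast
  have low: "K < ?q x + ?M'" if "1 \<le> x" "x \<le> ?M'" "\<forall>e\<in>set w. K \<le> fst e" for x K
    using IH that by auto
  have mono: "?q x < ?q y" if "1 \<le> x" "x < y" "y \<le> ?M'" for x y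
    using IH that by (auto elim!: strict_mono_onD)
  have p: "?p x = ?q (if 1 \<le> x \<and> x \<le> i then k - i + x else if i < x \<and> x \<le> k then x - i else x)"
    for x
    by (simp only: e ogs_value_simps perm_mult_apply ogs_gen_power_apply[OF ik])
  have full: "exp_above w u = ?M'" if "u \<le> k" for u
    using above_k that by (intro exp_above_eq_exp_sum) auto
  have p_first: "?p x = k - ?M + x" if x: "1 \<le> x" "x \<le> i" for x
  proof -
    have "?p x = ?q (Suc (k - i + x - 1))" using x by (simp add: p)
    also have "\<dots> = Suc (k - i + x - 1) - exp_above w (k - i + x - 1)"
      using x M Mk by (intro tail) linarith
    also have "exp_above w (k - i + x - 1) = ?M'" using x ik by (intro full) linarith
    finally show ?thesis using x M Mk by linarith
  qed
  have p_second: "?p x = ?q (x - i)" if "i < x" "x \<le> ?M" for x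
    using that Mk by (simp add: p)
  have p_tail: "?p (Suc u) = Suc u - exp_above (e # w) u" if u: "?M \<le> u" for u
  proof (cases "u < k")
    case True
    have "?p (Suc u) = ?q (Suc (u - i))" using u M True by (simp add: p Suc_diff_le)
    also have "\<dots> = Suc (u - i) - exp_above w (u - i)" using u M by (intro tail) linarith
    also have "\<dots> = Suc u - exp_above (e # w) u"
      using True u M full[of u] full[of "u - i"] by (simp add: e)
    finally show ?thesis .
  next
    case False
    then have "?p (Suc u) = ?q (Suc u)" using ik by (simp add: p)
    then show ?thesis using False u M tail[of u] by (simp add: e)
  qed
  have p_low: "K < ?p x + ?M" if x: "1 \<le> x" "x \<le> ?M" and K: "\<forall>e\<in>set (e # w). K \<le> fst e" for x K
  proof (cases "x \<le> i")
    case True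
    then show ?thesis using p_first x K Mk by (simp add: e)
  next
    case False
    then have "K < ?q (x - i) + ?M'" using x M K by (intro low) auto
    then show ?thesis using False x p_second M by simp
  qed
  have "?p x < ?p y" if xy: "1 \<le> x" "x < y" "y \<le> ?M" for x y
  proof -
    consider "y \<le> i" | "x \<le> i" "i < y" | "i < x" using xy by linarith
    then show ?thesis
    proof cases
      case 1
      then show ?thesis using xy p_first by simp
    next
      case 2
      have "k < ?q (y - i) + ?M'" using 2 xy M above_k by (intro low) auto
      then show ?thesis
        using 2 xy p_first[of x] p_second[of y] M Mk by linarith
    next
      case 3
      then show ?thesis using xy M p_second mono[of "x - i" "y - i"] by simp
    qed
  qed
  then have "strict_mono_on {1..?M} ?p" by (intro strict_mono_onI) auto
  then show ?case using p_tail p_low by auto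
qed

text \<open>
  The code of the value of an elementary expression: zero below the descent \<open>exp_sum f\<close>, non-increasing
  from there on, and zero again from the largest generator index on.
\<close>

definition elem_code :: "ogs_expr \<Rightarrow> nat \<Rightarrow> nat"
  where "elem_code f u = (if u < exp_sum f then 0 else exp_above f u)"

lemma elem_code_le: "elem_code f u \<le> u"
  using exp_above_le_exp_sum[of f u] by (simp add: elem_code_def)

lemma elementary_value_permutes: "ogs_elementary n f \<Longrightarrow> ogs_value f permutes {1..n}"
  by (rule ogs_value_permutes) (use ogs_elementaryD(3) in blast)

lemma inv_code_elementary:
  assumes f: "ogs_elementary n f" and u: "u < n"
  shows "inv_code (ogs_value f) u = elem_code f u"
proof -
  have "\<forall>e\<in>set f. exp_sum f \<le> fst e" using ogs_elementaryD(4)[OF f] by blast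
  note line = elementary_one_line[OF ogs_elementaryD(2)[OF f] this]
  show ?thesis
  proof (cases "u < exp_sum f")
    case True
    then have "\<not> ogs_value f (Suc u) < ogs_value f j" if "j \<in> {1..u}" for j
      using line strict_mono_onD[of "{1..exp_sum f}" "ogs_value f" j "Suc u"] that by auto
    then have none: "{j \<in> {1..u}. ogs_value f (Suc u) < ogs_value f j} = {}" by blast
    show ?thesis unfolding inv_code_def none using True by (simp add: elem_code_def)
  next
    case False
    have tail: "ogs_value f (Suc v) = Suc v - exp_above f v" if "exp_sum f \<le> v" for v
      using line that by blast
    have "inv_code (ogs_value f) u + ogs_value f (Suc u) = Suc u"
    proof (rule inv_code_increasing_after[OF elementary_value_permutes[OF f] u])
      fix j assume "Suc u < j" "j \<le> n"
      then obtain v where v: "j = Suc v" "u < v" by (cases j) auto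
      then show "ogs_value f (Suc u) < ogs_value f j"
        using False tail[of u] tail[of v] exp_above_antimono[of u v f]
          exp_above_le_exp_sum[of f u] by (simp only:) linarith
    qed
    moreover have "ogs_value f (Suc u) = Suc u - exp_above f u" using False by (intro tail) simp
    ultimately show ?thesis
      using False exp_above_le_exp_sum[of f u] by (simp add: elem_code_def)
  qed
qed

lemma elem_code_eq_0: "ogs_elementary n f \<Longrightarrow> fst (last f) \<le> u \<Longrightarrow> elem_code f u = 0"
  using ogs_elementaryD(5) exp_above_eq_0[of f u] by (fastforce simp: elem_code_def)

text \<open>
  The largest generator index exceeds \<open>exp_sum f\<close>, so at least its exponent contributes.
\<close>

lemma elem_code_at_exp_sum_pos:
  assumes "ogs_elementary n f" shows "0 < elem_code f (exp_sum f)"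
proof -
  have "last f \<in> set f" using ogs_elementaryD(1)[OF assms] by simp
  then have "snd (last f) \<le> exp_above f (exp_sum f)"
    unfolding exp_above_def
    by (intro member_le_sum_list) (use exp_sum_less_last[OF assms] in auto)
  then show ?thesis
    using ogs_elementaryD(3)[OF assms \<open>last f \<in> set f\<close>] by (simp add: elem_code_def)
qed

text \<open>
  A strictly sorted list of pairs with positive exponents is determined by its set, and the set consists
  of the pairs \<open>(k, exp_at v k)\<close> with non-zero second component.
\<close>

lemma sorted_expr_eqI:
  assumes "sorted_wrt (<) (map fst v)" "sorted_wrt (<) (map fst w)"
    and "\<forall>e\<in>set v. 0 < snd e" "\<forall>e\<in>set w. 0 < snd e"
    and "\<forall>k. exp_at v k = exp_at w k"
  shows "v = w"
proof -
  have mem: "e \<in> set x \<longleftrightarrow> exp_at x (fst e) = snd e"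
    if "sorted_wrt (<) (map fst x)" "\<forall>e\<in>set x. 0 < snd e" "0 < snd e" for x and e :: "nat \<times> nat"
    using that
  proof (induction x)
    case (Cons d x)
    show ?case
    proof (cases "fst d = fst e")
      case True
      then have "exp_at x (fst e) = 0" "e \<notin> set x"
        using Cons.prems by (auto intro!: exp_at_eq_0)
      with True show ?thesis by (auto simp: prod_eq_iff)
    next
      case False
      then show ?thesis using Cons by auto
    qed
  qed simp
  have set: "set v = set w"
    using mem[OF assms(1,3)] mem[OF assms(2,4)] assms(3-5) by (metis subsetI subset_antisym)
  then have "map fst v = map fst w"
    using assms(1,2) by (intro sorted_distinct_set_unique) (auto simp: strict_sorted_iff)
  moreover have "inj_on fst (set v \<union> set w)"
    using assms(1) set by (simp add: strict_sorted_iff distinct_map)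
  ultimately show ?thesis
    using map_inj_on by blast
qed

text \<open>
  The exponent of \<open>t\<^sub>k\<close> is the drop of the code from \<open>k - 1\<close> to \<open>k\<close>.  The exception is \<open>k = exp_sum f\<close>,
  the least index possible, where the code starts; there the exponent is what is missing from the exponent
  sum.
\<close>

lemma elementary_eqI:
  assumes f: "ogs_elementary n f" and g: "ogs_elementary n g"
    and sum: "exp_sum f = exp_sum g" and code: "\<forall>u. elem_code f u = elem_code g u"
  shows "f = g"
proof (rule sorted_expr_eqI)
  have above: "exp_above f u = exp_above g u" if "exp_sum f \<le> u" for u
    using code[rule_format, of u] sum that by (simp add: elem_code_def)
  show "\<forall>k. exp_at f k = exp_at g k"
  proof
    fix k
    have low: "\<forall>e\<in>set f. exp_sum f \<le> fst e" "\<forall>e\<in>set g. exp_sum f \<le> fst e"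
      using ogs_elementaryD(4)[OF f] ogs_elementaryD(4)[OF g] unfolding sum by blast+
    show "exp_at f k = exp_at g k"
    proof (cases k "exp_sum f" rule: linorder_cases)
      case less
      then have "exp_at f k = 0" "exp_at g k = 0" using low by (intro exp_at_eq_0; force)+
      then show ?thesis by simp
    next
      case equal
      have "exp_sum f = exp_at f k + exp_above f k" "exp_sum g = exp_at g k + exp_above g k"
        using low equal by (intro exp_sum_split; simp)+
      with sum above[of k] equal show ?thesis by linarith
    next
      case greater
      then obtain u where k: "k = Suc u" and u: "exp_sum f \<le> u" by (cases k) auto
      have "exp_above f (Suc u) = exp_above g (Suc u)" using u by (intro above) simp
      with above[OF u] exp_above_step[of f u] exp_above_step[of g u] show ?thesis
        unfolding k by linarith
    qed
  qed
qed (use ogs_elementaryD[OF f] ogs_elementaryD[OF g] in auto)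

text \<open>
  Exchanging the order of summation, the exponent \<open>i\<close> of \<open>t\<^sub>k\<close> is counted for the \<open>k - M\<close> arguments
  \<open>u \<in> {M..<k}\<close>, where \<open>M\<close> is the exponent sum; in total this gives \<open>\<Sum> k i - M\<^sup>2\<close>.
\<close>

lemma sum_elem_code:
  assumes "ogs_elementary n f"
  shows "(\<Sum>u<n. elem_code f u) + (exp_sum f)\<^sup>2 = (\<Sum>e\<leftarrow>f. fst e * snd e)"
proof -
  \<comment> \<open>The lower limit \<open>m\<close> is kept fixed while the exponent sum changes along the induction.\<close>
  have "(\<Sum>u\<in>{m..<n}. exp_above g u) + exp_sum g * m = (\<Sum>e\<leftarrow>g. fst e * snd e)"
    if "\<forall>e\<in>set g. m \<le> fst e \<and> fst e \<le> n" for g m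
    using that
  proof (induction g)
    case (Cons e g)
    have "(\<Sum>u\<in>{m..<n}. if u < fst e then snd e else 0) = (\<Sum>u\<in>{m..<fst e}. snd e)"
      using Cons.prems by (intro sum.mono_neutral_cong_right) auto
    then have "(\<Sum>u\<in>{m..<n}. if u < fst e then snd e else 0) + m * snd e = fst e * snd e"
      using Cons.prems by (simp add: add_mult_distrib[symmetric])
    then show ?case
      using Cons by (simp add: sum.distrib algebra_simps)
  qed simp
  moreover have "\<forall>e\<in>set f. exp_sum f \<le> fst e \<and> fst e \<le> n"
    using ogs_elementaryD(3,4)[OF assms] by blast
  moreover have "(\<Sum>u<n. elem_code f u) = (\<Sum>u\<in>{exp_sum f..<n}. exp_above f u)"
    by (intro sum.mono_neutral_cong_right) (auto simp: elem_code_def)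
  ultimately show ?thesis by (simp add: power2_eq_square)
qed


section \<open>Chains of elementary expressions\<close>

text \<open>
  The inequality is required for all pairs of factors, not only for neighbours.  For elementary factors
  this is the same, and it makes inductions over \<open>F\<close> direct.
\<close>

definition elementary_chain :: "nat \<Rightarrow> ogs_expr list \<Rightarrow> bool"
  where "elementary_chain n F \<longleftrightarrow> (\<forall>f \<in> set F. ogs_elementary n f) \<and>
    sorted_wrt (\<lambda>f g. fst (last f) \<le> exp_sum g) F"

definition chain_code :: "ogs_expr list \<Rightarrow> nat \<Rightarrow> nat"
  where "chain_code F u = (\<Sum>f\<leftarrow>F. elem_code f u)"

abbreviation chain_value :: "ogs_expr list \<Rightarrow> nat \<Rightarrow> nat"
  where "chain_value F \<equiv> perm_prod (map ogs_value F)"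

lemma chain_code_simps [simp]:
  "chain_code [] u = 0" "chain_code (f # F) u = elem_code f u + chain_code F u"
  by (simp_all add: chain_code_def)

lemma elementary_chain_Cons:
  "elementary_chain n (f # F) \<longleftrightarrow>
    ogs_elementary n f \<and> (\<forall>g\<in>set F. fst (last f) \<le> exp_sum g) \<and> elementary_chain n F"
  by (auto simp: elementary_chain_def)

lemma elementary_presentation_iff:
  "elementary_presentation n p F \<longleftrightarrow> elementary_chain n F \<and> p = chain_value F"
proof -
  have "(\<forall>v. 0 < v \<and> v < length F \<longrightarrow> fst (last (F ! (v - 1))) \<le> exp_sum (F ! v)) \<longleftrightarrow>
      sorted_wrt (\<lambda>f g. fst (last f) \<le> exp_sum g) F" (is "?adj \<longleftrightarrow> ?sorted")
    if el: "\<forall>f \<in> set F. ogs_elementary n f"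
  proof
    assume adj: ?adj
    have "fst (last (F ! i)) \<le> exp_sum (F ! j)" if "i < j" "j < length F" for i j
      using that
    proof (induction j)
      case (Suc j)
      have step: "fst (last (F ! j)) \<le> exp_sum (F ! Suc j)"
        using adj[rule_format, of "Suc j"] Suc.prems by simp
      show ?case
      proof (cases "i = j")
        case False
        then have "fst (last (F ! i)) \<le> exp_sum (F ! j)" using Suc by simp
        also have "\<dots> < fst (last (F ! j))"
          using el Suc.prems by (intro exp_sum_less_last[of n]) simp
        finally show ?thesis using step by simp
      qed (use step in simp)
    qed simp
    then show ?sorted by (simp add: sorted_wrt_iff_nth_less)
  next
    assume ?sorted
    then show ?adj by (simp add: sorted_wrt_iff_nth_less)
  qed
  then show ?thesis unfolding elementary_presentation_def elementary_chain_def by blast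
qed

lemma chain_code_eq_0:
  "elementary_chain n F \<Longrightarrow> \<forall>f\<in>set F. u < exp_sum f \<or> fst (last f) \<le> u \<Longrightarrow> chain_code F u = 0"
proof (induction F)
  case (Cons f F)
  have "elem_code f u = 0"
  proof (cases "u < exp_sum f")
    case False
    then show ?thesis
      using Cons.prems by (intro elem_code_eq_0[of n]) (auto simp: elementary_chain_Cons)
  qed (simp add: elem_code_def)
  then show ?case using Cons by (simp add: elementary_chain_Cons)
qed simp

text \<open>
  The codes of the factors live on the disjoint intervals from \<open>exp_sum f\<close> to \<open>fst (last f)\<close>, which come
  in increasing order.  Hence their sum is again a valid exponent sequence, and its normal word is the
  concatenation.
\<close>

lemma chain_code_le_and_normal_word:
  assumes "elementary_chain n F"
  shows "(\<forall>u. chain_code F u \<le> u) \<and>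
    normal_word n (chain_code F) = concat (map (\<lambda>f. normal_word n (elem_code f)) F)"
  using assms
proof (induction F)
  case Nil
  have "chain_code [] = (\<lambda>u. 0)" by (rule ext) simp
  moreover have "normal_word n (\<lambda>u. 0) = []" by (simp add: normal_word_def)
  ultimately show ?case by simp
next
  case (Cons f F)
  let ?m = "fst (last f)"
  have f: "ogs_elementary n f" and F: "elementary_chain n F"
    and above: "\<forall>g\<in>set F. ?m \<le> exp_sum g"
    using Cons.prems by (auto simp: elementary_chain_Cons)
  have high: "elem_code f u = 0" if "?m \<le> u" for u using elem_code_eq_0[OF f that] .
  have low: "chain_code F u = 0" if "u < ?m" for u
    using above that by (intro chain_code_eq_0[OF F]) auto
  have le: "chain_code F u \<le> u" for u using Cons.IH[OF F] by blast
  have "elem_code f u + chain_code F u \<le> u" for u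
    using high[of u] low[of u] elem_code_le[of f u] le[of u] by (cases "u < ?m") auto
  moreover have "normal_word n (\<lambda>u. elem_code f u + chain_code F u)
      = normal_word n (elem_code f) @ normal_word n (chain_code F)"
    using high low elem_code_le le by (intro normal_word_add[of ?m]) auto
  moreover have "chain_code (f # F) = (\<lambda>u. elem_code f u + chain_code F u)" by (rule ext) simp
  ultimately show ?case using Cons.IH[OF F] by simp
qed

lemma normal_form_elementary:
  assumes "ogs_elementary n f"
  shows "normal_form n (ogs_value f) = normal_word n (elem_code f)"
  unfolding normal_form_eq[OF elementary_value_permutes[OF assms]]
  by (rule normal_word_cong) (rule inv_code_elementary[OF assms])

lemma word_perm_normal_word_elem_code:
  assumes "ogs_elementary n f"
  shows "word_perm (normal_word n (elem_code f)) = ogs_value f"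
proof -
  have "normal_word n (elem_code f) = normal_word n (inv_code (ogs_value f))"
    by (rule normal_word_cong) (rule inv_code_elementary[OF assms, symmetric])
  then show ?thesis
    by (simp only: word_perm_normal_word_inv_code[OF elementary_value_permutes[OF assms]])
qed

lemma word_perm_chain:
  assumes "elementary_chain n F"
  shows "word_perm (normal_word n (chain_code F)) = chain_value F"
proof -
  have "word_perm (concat (map (\<lambda>f. normal_word n (elem_code f)) F)) = chain_value F"
    using assms
  proof (induction F)
    case (Cons f F)
    then show ?case
      unfolding elementary_chain_Cons list.map concat.simps word_perm_append perm_prod_simps
      by (simp only: word_perm_normal_word_elem_code)
  qed simp
  then show ?thesis by (simp only: chain_code_le_and_normal_word[OF assms])
qed

lemma chain_value_permutes:
  assumes "elementary_chain n F" shows "chain_value F permutes {1..n}"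
proof -
  have "set (normal_word n (chain_code F)) \<subseteq> {1..n - 1}"
    using chain_code_le_and_normal_word[OF assms] by (intro set_normal_word) blast
  from word_perm_permutes[OF this] show ?thesis unfolding word_perm_chain[OF assms] .
qed

lemma inv_code_chain_value:
  assumes "elementary_chain n F" "u < n"
  shows "inv_code (chain_value F) u = chain_code F u"
  using inv_code_word_perm_normal_word[of n "chain_code F" u] assms(2)
    chain_code_le_and_normal_word[OF assms(1)] unfolding word_perm_chain[OF assms(1)] by blast

lemma normal_form_chain_value:
  assumes "elementary_chain n F"
  shows "normal_form n (chain_value F) = concat (map (\<lambda>f. normal_form n (ogs_value f)) F)"
proof -
  have "normal_form n (chain_value F) = normal_word n (chain_code F)"
    unfolding normal_form_eq[OF chain_value_permutes[OF assms]]
    by (rule normal_word_cong) (rule inv_code_chain_value[OF assms])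
  also have "\<dots> = concat (map (\<lambda>f. normal_word n (elem_code f)) F)"
    using chain_code_le_and_normal_word[OF assms] by blast
  also have "map (\<lambda>f. normal_word n (elem_code f)) F = map (\<lambda>f. normal_form n (ogs_value f)) F"
    using assms normal_form_elementary by (intro map_cong) (auto simp: elementary_chain_def)
  finally show ?thesis .
qed

lemma exp_sum_increasing:
  assumes "elementary_chain n F" shows "sorted_wrt (<) (map exp_sum F)"
  using assms
proof (induction F)
  case (Cons f F)
  then have "exp_sum f < fst (last f)" "\<forall>g\<in>set F. fst (last f) \<le> exp_sum g"
    using exp_sum_less_last by (auto simp: elementary_chain_Cons)
  then show ?case using Cons by (fastforce simp: elementary_chain_Cons)
qed simp

lemma perm_des_chain_iff:
  assumes "elementary_chain n F"
  shows "r \<in> perm_des n (chain_value F) \<longleftrightarrow>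
    r \<in> {1..n - 1} \<and> chain_code F (r - 1) < chain_code F r"
proof -
  have "inv_code (chain_value F) (r - 1) = chain_code F (r - 1)"
    "inv_code (chain_value F) r = chain_code F r" if "r \<in> {1..n - 1}"
    using that by (auto intro!: inv_code_chain_value[OF assms])
  then show ?thesis
    unfolding perm_des_iff_inv_code[OF chain_value_permutes[OF assms]] by metis
qed

text \<open>
  A single elementary code rises only at its own exponent sum, so a sum of such codes rises at no other
  place.  This bounds the number of descents by the number of factors of any presentation.
\<close>

lemma perm_des_chain_subset:
  assumes "elementary_chain n F"
  shows "perm_des n (chain_value F) \<subseteq> exp_sum ` set F"
proof (rule ccontr)
  assume "\<not> ?thesis"
  then obtain r where r: "r \<in> perm_des n (chain_value F)" "r \<notin> exp_sum ` set F" by blast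
  have "elem_code f r \<le> elem_code f (r - 1)" if "f \<in> set F" for f
  proof -
    have "r \<noteq> exp_sum f" using r that by blast
    then show ?thesis
      using exp_above_antimono[of "r - 1" r f] by (auto simp: elem_code_def)
  qed
  then have "chain_code F r \<le> chain_code F (r - 1)"
    unfolding chain_code_def by (rule sum_list_mono)
  then show False using r perm_des_chain_iff[OF assms] by auto
qed

text \<open>
  The sum of the codes fails to rise at \<open>exp_sum g\<close> only if the preceding factor ends there with a
  code entry at least as large as the first non-zero code entry of \<open>g\<close>.  This happens if that factor
  ends with \<open>t\<^sub>k\<^sup>a\<close> and \<open>g\<close> begins with \<open>t\<^sub>k\<^sup>b\<close>, where \<open>a + b \<ge> k = exp_sum g\<close>; the condition excludes it.
\<close>

definition descent_exact :: "ogs_expr list \<Rightarrow> bool"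
  where "descent_exact F \<longleftrightarrow>
    sorted_wrt (\<lambda>f g. elem_code f (exp_sum g - 1) < elem_code g (exp_sum g)) F"

text \<open>
  Just below \<open>exp_sum g\<close> the code of the chain vanishes unless some factor has its largest index equal to
  \<open>exp_sum g\<close>.  There is at most one such factor, the one in front of \<open>g\<close>, and for it \<^const>\<open>descent_exact\<close>
  makes the comparison.
\<close>

lemma chain_code_rises:
  assumes "elementary_chain n F" "descent_exact F" "g \<in> set F"
  shows "chain_code F (exp_sum g - 1) < chain_code F (exp_sum g)"
  using assms
proof (induction F)
  case (Cons f F)
  have f: "ogs_elementary n f" and F: "elementary_chain n F"
    and above: "\<forall>h\<in>set F. fst (last f) \<le> exp_sum h"
    using Cons.prems by (auto simp: elementary_chain_Cons)
  have exact: "descent_exact F"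
    and f_exact: "\<forall>h\<in>set F. elem_code f (exp_sum h - 1) < elem_code h (exp_sum h)"
    using Cons.prems by (auto simp: descent_exact_def)
  show ?case
  proof (cases "g = f")
    case True
    have "exp_sum f - 1 < exp_sum h" if "h \<in> set F" for h
      using above that exp_sum_less_last[OF f] by fastforce
    then have "chain_code F (exp_sum f - 1) = 0" by (intro chain_code_eq_0[OF F]) blast
    moreover have "elem_code f (exp_sum f - 1) = 0"
      using ogs_elementaryD(7)[OF f] by (simp add: elem_code_def)
    ultimately show ?thesis using True elem_code_at_exp_sum_pos[OF f] by simp
  next
    case False
    then have g: "g \<in> set F" using Cons.prems by simp
    show ?thesis
    proof (cases "fst (last f) < exp_sum g")
      case True
      then have "elem_code f (exp_sum g - 1) = 0" by (intro elem_code_eq_0[OF f]) simp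
      then show ?thesis using Cons.IH[OF F exact g] by simp
    next
      case False
      then have eq: "exp_sum g = fst (last f)" using above g by fastforce
      have pos: "0 < exp_sum g"
        using F g ogs_elementaryD(7) by (auto simp: elementary_chain_def)
      have "exp_sum g - 1 < exp_sum h" if "h \<in> set F" for h
        using above that eq pos by fastforce
      then have "chain_code F (exp_sum g - 1) = 0" by (intro chain_code_eq_0[OF F]) blast
      moreover have "elem_code g (exp_sum g) \<le> chain_code F (exp_sum g)"
        unfolding chain_code_def using g by (intro member_le_sum_list) auto
      ultimately show ?thesis using f_exact g by fastforce
    qed
  qed
qed simp

lemma perm_des_descent_exact:
  assumes "elementary_chain n F" "descent_exact F"
  shows "perm_des n (chain_value F) = exp_sum ` set F"
proof
  show "perm_des n (chain_value F) \<subseteq> exp_sum ` set F" by (rule perm_des_chain_subset[OF assms(1)])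
  show "exp_sum ` set F \<subseteq> perm_des n (chain_value F)"
  proof
    fix r assume "r \<in> exp_sum ` set F"
    then obtain g where g: "g \<in> set F" "r = exp_sum g" by blast
    then have el: "ogs_elementary n g" using assms(1) by (simp add: elementary_chain_def)
    have "fst (last g) \<le> n" using ogs_elementaryD(1,3)[OF el] by simp
    then have "r \<in> {1..n - 1}"
      using g ogs_elementaryD(7)[OF el] exp_sum_less_last[OF el] by auto
    then show "r \<in> perm_des n (chain_value F)"
      using perm_des_chain_iff[OF assms(1)] chain_code_rises[OF assms g(1)] g(2) by simp
  qed
qed

text \<open>
  Up to the exponent sum of the second factor the code of the chain is the code of the first factor, and
  from there on that code vanishes.  So the first factor can be read off and split off.
\<close>

lemma elementary_chain_eqI:
  assumes "elementary_chain n F" "elementary_chain n G"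
    and "map exp_sum F = map exp_sum G" "\<And>u. chain_code F u = chain_code G u"
  shows "F = G"
  using assms
proof (induction F arbitrary: G)
  case (Cons f F)
  then obtain g G' where G: "G = g # G'" by (cases G) auto
  have f: "ogs_elementary n f" and F: "elementary_chain n F"
    and f_above: "\<forall>h\<in>set F. fst (last f) \<le> exp_sum h"
    and g: "ogs_elementary n g" and G': "elementary_chain n G'"
    and g_above: "\<forall>h\<in>set G'. fst (last g) \<le> exp_sum h"
    using Cons.prems unfolding G by (auto simp: elementary_chain_Cons)
  have sums: "exp_sum f = exp_sum g" "map exp_sum F = map exp_sum G'"
    using Cons.prems G by auto
  have sum_sets: "exp_sum ` set F = exp_sum ` set G'"
    using arg_cong[OF sums(2), of set] by simp
  have code: "elem_code f u + chain_code F u = elem_code g u + chain_code G' u" for u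
    using Cons.prems(4)[of u] G by simp
  have "elem_code f u = elem_code g u" for u
  proof (cases "\<exists>h\<in>set F. exp_sum h \<le> u")
    case True
    then have "fst (last f) \<le> u" using f_above by fastforce
    moreover obtain m where "m \<in> exp_sum ` set F" "m \<le> u" using True by blast
    then have "m \<in> exp_sum ` set G'" "m \<le> u" unfolding sum_sets by auto
    then have "fst (last g) \<le> u" using g_above by fastforce
    ultimately show ?thesis using elem_code_eq_0[OF f] elem_code_eq_0[OF g] by simp
  next
    case False
    then have "\<forall>m\<in>exp_sum ` set F. u < m" by fastforce
    then have "\<forall>h\<in>set F. u < exp_sum h" "\<forall>h\<in>set G'. u < exp_sum h"
      unfolding sum_sets by (fastforce simp: sum_sets[symmetric])+
    then have "chain_code F u = 0" "chain_code G' u = 0"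
      using chain_code_eq_0[OF F] chain_code_eq_0[OF G'] by blast+
    then show ?thesis using code[of u] by simp
  qed
  moreover from this have "f = g" using elementary_eqI[OF f g sums(1)] by blast
  moreover have "F = G'"
    using Cons.IH[OF F G' sums(2)] code calculation(1) by (metis add_left_cancel)
  ultimately show ?case using G by simp
qed simp

text \<open>
  Every presentation has at least as many factors as there are descents, and \<open>F\<close> has exactly that many.
  In another presentation of that length the exponent sums must be the descents as well, so it has the
  same exponent sums and the same code as \<open>F\<close>.
\<close>

lemma descent_exact_elementary_factorization:
  assumes F: "elementary_chain n F" "descent_exact F"
  shows "elementary_factorization n (chain_value F) G \<longleftrightarrow> G = F"
proof -
  let ?D = "perm_des n (chain_value F)"
  have distinct: "distinct (map exp_sum G)" if "elementary_chain n G" for G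
    using exp_sum_increasing[OF that] by (simp add: strict_sorted_iff)
  have card: "card (exp_sum ` set G) = length G" if "elementary_chain n G" for G
    using distinct_card[OF distinct[OF that]] by simp
  have D: "?D = exp_sum ` set F" using F by (rule perm_des_descent_exact)
  have count: "elementary_factor_count n (chain_value F) = length F"
    unfolding elementary_factor_count_def
  proof (rule Least_equality)
    show "\<exists>G. elementary_presentation n (chain_value F) G \<and> length G = length F"
      using F(1) elementary_presentation_iff by blast
  next
    fix z assume "\<exists>G. elementary_presentation n (chain_value F) G \<and> length G = z"
    then obtain G where G: "elementary_chain n G" "chain_value F = chain_value G" "length G = z"
      using elementary_presentation_iff by blast
    have "?D \<subseteq> exp_sum ` set G" unfolding G(2) by (rule perm_des_chain_subset[OF G(1)])
    then have "card ?D \<le> card (exp_sum ` set G)" by (intro card_mono) auto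
    then show "length F \<le> z" unfolding D card[OF F(1)] card[OF G(1)] G(3) .
  qed
  have "G = F" if G: "elementary_chain n G" "chain_value F = chain_value G" "length G = length F"
  proof (rule elementary_chain_eqI[OF G(1) F(1)])
    have "exp_sum ` set F \<subseteq> exp_sum ` set G"
      unfolding D[symmetric] G(2) by (rule perm_des_chain_subset[OF G(1)])
    then have "exp_sum ` set F = exp_sum ` set G"
      by (intro card_subset_eq) (simp_all add: card F(1) G(1,3))
    then show "map exp_sum G = map exp_sum F"
      using exp_sum_increasing[OF F(1)] exp_sum_increasing[OF G(1)]
      by (intro sorted_distinct_set_unique) (simp_all add: strict_sorted_iff)
    have le_n: "fst (last h) \<le> n" if "elementary_chain n H" "h \<in> set H" for h H
    proof -
      have "ogs_elementary n h" using that by (simp add: elementary_chain_def)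
      then show ?thesis using ogs_elementaryD(1,3)[of n h] by simp
    qed
    fix u show "chain_code G u = chain_code F u"
    proof (cases "u < n")
      case True
      have "chain_code F u = inv_code (chain_value F) u"
        using inv_code_chain_value[OF F(1) True] by simp
      also have "\<dots> = chain_code G u" unfolding G(2) by (rule inv_code_chain_value[OF G(1) True])
      finally show ?thesis by simp
    next
      case False
      have "chain_code G u = 0"
        using le_n[OF G(1)] False by (intro chain_code_eq_0[OF G(1)]) fastforce
      moreover have "chain_code F u = 0"
        using le_n[OF F(1)] False by (intro chain_code_eq_0[OF F(1)]) fastforce
      ultimately show ?thesis by simp
    qed
  qed
  then show ?thesis
    unfolding elementary_factorization_def elementary_presentation_iff count
    using F(1) by blast
qed


section \<open>Factoring a canonical form\<close>

text \<open>
  Prepends \<open>t\<^sub>k\<^sup>i\<close>, with \<open>k\<close> below all indices in the chain, to a factorization.  As much of the exponent as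
  possible goes into the first factor, whose exponent sum must not exceed \<open>k\<close>; the rest starts a new
  factor.  When \<open>t\<^sub>k\<close> is split, the old first factor ends up with exponent sum exactly \<open>k\<close>, as the chain
  condition demands.
\<close>

fun insert_factor :: "nat \<times> nat \<Rightarrow> ogs_expr list \<Rightarrow> ogs_expr list" where
  "insert_factor (k, i) [] = [[(k, i)]]"
| "insert_factor (k, i) (f # F) =
    (if i + exp_sum f \<le> k then ((k, i) # f) # F
     else if exp_sum f < k then [(k, i - (k - exp_sum f))] # ((k, k - exp_sum f) # f) # F
     else [(k, i)] # f # F)"

text \<open>
  The three shapes of the result, with the arithmetic of the splitting point hidden in \<open>i = a + b\<close>.
\<close>

lemma insert_factor_cases:
  obtains "insert_factor (k, i) F = [(k, i)] # F"
  | f G where "F = f # G" "insert_factor (k, i) F = ((k, i) # f) # G"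
  | f G a b where "F = f # G" "i = a + b"
      "insert_factor (k, i) F = [(k, a)] # ((k, b) # f) # G"
proof (cases F)
  case Nil
  then show ?thesis using that(1) by simp
next
  case (Cons f G)
  consider "i + exp_sum f \<le> k" | "k < i + exp_sum f" "exp_sum f < k"
    | "k < i + exp_sum f" "k \<le> exp_sum f"
    by linarith
  then show ?thesis
  proof cases
    case 1
    then show ?thesis using that(2)[OF Cons] Cons by simp
  next
    case 2
    then have "i = (i - (k - exp_sum f)) + (k - exp_sum f)" by linarith
    moreover have "insert_factor (k, i) F =
        [(k, i - (k - exp_sum f))] # ((k, k - exp_sum f) # f) # G"
      using 2 Cons by simp
    ultimately show ?thesis using that(3)[OF Cons] by blast
  next
    case 3
    then show ?thesis using that(1) Cons by simp
  qed
qed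

lemma insert_factor_preserves:
  shows "chain_value (insert_factor (k, i) F) = (ogs_gen k ^^ i) \<cdot> chain_value F"
    and "fst ` set (concat (insert_factor (k, i) F)) = insert k (fst ` set (concat F))"
    and "exp_at (concat (insert_factor (k, i) F)) x = exp_at ((k, i) # concat F) x"
    and "(\<Sum>e\<leftarrow>concat (insert_factor (k, i) F). fst e * snd e)
      = k * i + (\<Sum>e\<leftarrow>concat F. fst e * snd e)"
proof -
  have pow: "(ogs_gen k ^^ (a + b)) \<cdot> p = (ogs_gen k ^^ a) \<cdot> ((ogs_gen k ^^ b) \<cdot> p)" for a b p
    by (rule ext) (simp only: perm_mult_apply add.commute[of a b] funpow_add comp_apply)
  note value_simps = list.map perm_prod_simps ogs_value_simps id_perm_mult perm_mult_assoc
  show "chain_value (insert_factor (k, i) F) = (ogs_gen k ^^ i) \<cdot> chain_value F"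
  proof (cases k i F rule: insert_factor_cases)
    case 1
    then show ?thesis by (simp only: value_simps)
  next
    case (2 f G)
    then show ?thesis by (simp only: value_simps)
  next
    case (3 f G a b)
    then show ?thesis by (simp only: value_simps pow)
  qed
  show "fst ` set (concat (insert_factor (k, i) F)) = insert k (fst ` set (concat F))"
    by (cases k i F rule: insert_factor_cases) auto
  show "exp_at (concat (insert_factor (k, i) F)) x = exp_at ((k, i) # concat F) x"
    by (cases k i F rule: insert_factor_cases) auto
  show "(\<Sum>e\<leftarrow>concat (insert_factor (k, i) F). fst e * snd e)
      = k * i + (\<Sum>e\<leftarrow>concat F. fst e * snd e)"
    by (cases k i F rule: insert_factor_cases) (auto simp: algebra_simps)
qed

lemma ogs_elementary_singleton:
  "2 \<le> k \<Longrightarrow> k \<le> n \<Longrightarrow> 0 < a \<Longrightarrow> a < k \<Longrightarrow> ogs_elementary n [(k, a)]"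
  by (simp add: ogs_elementary_def ogs_canonical_def)

lemma ogs_elementary_Cons:
  assumes "ogs_elementary n f" "\<forall>e\<in>set f. k < fst e" "2 \<le> k" "k \<le> n" "0 < i"
    "i + exp_sum f \<le> k"
  shows "ogs_elementary n ((k, i) # f)"
  using assms ogs_elementaryD(7)[OF assms(1)]
  by (auto simp: ogs_elementary_def ogs_canonical_def)

text \<open>
  Extending the first factor on the left by a smaller index changes its code only up to \<open>k\<close>, and later
  factors start beyond \<open>k\<close>.
\<close>

lemma chain_extend_first:
  assumes ch: "elementary_chain n (f # F)" "descent_exact (f # F)"
    and k: "\<forall>e\<in>set f. k < fst e" "2 \<le> k" "k \<le> n" and i: "0 < i" "i + exp_sum f \<le> k"
  shows "elementary_chain n (((k, i) # f) # F) \<and> descent_exact (((k, i) # f) # F)"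
proof -
  have f: "ogs_elementary n f" and F: "elementary_chain n F"
    and above: "\<forall>g\<in>set F. fst (last f) \<le> exp_sum g"
    using ch by (auto simp: elementary_chain_Cons)
  have last: "last ((k, i) # f) = last f" "k < fst (last f)"
    using ogs_elementaryD(1)[OF f] k by auto
  have "elem_code ((k, i) # f) (exp_sum g - 1) = elem_code f (exp_sum g - 1)" if "g \<in> set F" for g
  proof -
    have "k < exp_sum g" using above that last by fastforce
    then have "\<not> exp_sum g - 1 < k" by linarith
    then show ?thesis using i by (simp add: elem_code_def)
  qed
  then show ?thesis
    using ch above last ogs_elementary_Cons[OF f k(1-3) i]
    by (auto simp: elementary_chain_Cons descent_exact_def)
qed

lemma chain_prepend_singleton:
  assumes ch: "elementary_chain n (f # F)" "descent_exact (f # F)"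
    and k: "2 \<le> k" "k \<le> n" "k \<le> exp_sum f" and a: "0 < a" "a < k"
    and rise: "elem_code [(k, a)] (exp_sum f - 1) < elem_code f (exp_sum f)"
  shows "elementary_chain n ([(k, a)] # f # F) \<and> descent_exact ([(k, a)] # f # F)"
proof -
  have f: "ogs_elementary n f" and above: "\<forall>g\<in>set F. fst (last f) \<le> exp_sum g"
    and el: "\<forall>g\<in>set F. ogs_elementary n g"
    using ch by (auto simp: elementary_chain_Cons elementary_chain_def)
  have ka: "ogs_elementary n [(k, a)]" using k a by (intro ogs_elementary_singleton)
  have less: "k < exp_sum g" if "g \<in> set F" for g
    using above that exp_sum_less_last[OF f] k by fastforce
  have "elem_code [(k, a)] (exp_sum g - 1) < elem_code g (exp_sum g)" if "g \<in> set F" for g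
  proof -
    have "elem_code [(k, a)] (exp_sum g - 1) = 0"
      using less[OF that] by (intro elem_code_eq_0[OF ka]) simp
    then show ?thesis using elem_code_at_exp_sum_pos[of n g] el that by simp
  qed
  then show ?thesis
    using ch ka k(3) less rise less_imp_le
    by (auto simp: elementary_chain_Cons descent_exact_def)
qed

text \<open>
  Where a new factor \<open>t\<^sub>k\<^sup>a\<close> is created in front of a factor with exponent sum \<open>k\<close>, exactness comes from
  \<open>i < k\<close>: the code of that factor starts with the sum of its exponents other than that of \<open>t\<^sub>k\<close>, which is
  more than \<open>a\<close> because \<open>t\<^sub>k\<close> has total exponent \<open>i\<close>.
\<close>

lemma insert_factor_chain:
  assumes ch: "elementary_chain n F" "descent_exact F"
    and above: "\<forall>f\<in>set F. \<forall>e\<in>set f. k < fst e"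
    and k: "2 \<le> k" "k \<le> n" and i: "0 < i" "i < k"
  shows "elementary_chain n (insert_factor (k, i) F) \<and> descent_exact (insert_factor (k, i) F)"
proof (cases F)
  case Nil
  then show ?thesis
    using ogs_elementary_singleton[OF k i] by (simp add: elementary_chain_def descent_exact_def)
next
  case (Cons f G)
  have above_f: "\<forall>e\<in>set f. k < fst e" using above Cons by simp
  note ch = ch[unfolded Cons]
  consider "i + exp_sum f \<le> k" | "k < i + exp_sum f" "exp_sum f < k" | "k \<le> exp_sum f"
    by linarith
  then show ?thesis
  proof cases
    case 1
    then show ?thesis using chain_extend_first[OF ch above_f k i(1)] Cons by simp
  next
    case 2
    \<comment> \<open>\<open>?b\<close> is the part of \<open>i\<close> that lifts the exponent sum of \<open>f\<close> to \<open>k\<close>.\<close>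
    let ?b = "k - exp_sum f"
    let ?a = "i - ?b"
    have ext: "elementary_chain n (((k, ?b) # f) # G)" "descent_exact (((k, ?b) # f) # G)"
      using chain_extend_first[OF ch above_f k, of ?b] 2 by auto
    have "elem_code [(k, ?a)] (k - 1) = ?a" using 2 i k by (simp add: elem_code_def)
    moreover have "elem_code ((k, ?b) # f) k = exp_sum f"
      using 2 above_f by (simp add: elem_code_def exp_above_eq_exp_sum)
    ultimately have "elem_code [(k, ?a)] (exp_sum ((k, ?b) # f) - 1)
        < elem_code ((k, ?b) # f) (exp_sum ((k, ?b) # f))"
      using 2 i by simp
    then show ?thesis
      using chain_prepend_singleton[OF ext k, of ?a] 2 i Cons by simp
  next
    case 3
    have "elem_code [(k, i)] (exp_sum f - 1) < elem_code f (exp_sum f)"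
    proof (cases "k = exp_sum f")
      case True
      then have "elem_code f (exp_sum f) = k"
        using above_f by (simp add: elem_code_def exp_above_eq_exp_sum)
      moreover have "elem_code [(k, i)] (exp_sum f - 1) \<le> i" by (simp add: elem_code_def)
      ultimately show ?thesis using i by simp
    next
      case False
      then have "elem_code [(k, i)] (exp_sum f - 1) = 0"
        using 3 by (intro elem_code_eq_0[OF ogs_elementary_singleton[OF k i]]) simp
      then show ?thesis using elem_code_at_exp_sum_pos[of n f] ch by (simp add: elementary_chain_Cons)
    qed
    then show ?thesis using chain_prepend_singleton[OF ch k 3 i] 3 i Cons by simp
  qed
qed

lemma foldr_insert_factor_preserves:
  shows "chain_value (foldr insert_factor w []) = ogs_value w"
    and "fst ` set (concat (foldr insert_factor w [])) = fst ` set w"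
    and "exp_at (concat (foldr insert_factor w [])) x = exp_at w x"
    and "(\<Sum>e\<leftarrow>concat (foldr insert_factor w []). fst e * snd e) = (\<Sum>e\<leftarrow>w. fst e * snd e)"
proof -
  show "chain_value (foldr insert_factor w []) = ogs_value w"
  proof (induction w)
    case Nil
    show ?case by (simp only: foldr.simps id_apply list.map perm_prod_simps ogs_value_simps)
  next
    case (Cons e w)
    obtain k i where e: "e = (k, i)" by (cases e)
    show ?case
      by (simp only: e foldr.simps comp_apply insert_factor_preserves(1) ogs_value_simps Cons.IH)
  qed
  show "fst ` set (concat (foldr insert_factor w [])) = fst ` set w"
  proof (induction w)
    case (Cons e w)
    obtain k i where e: "e = (k, i)" by (cases e)
    show ?case
      by (simp only: e foldr.simps comp_apply insert_factor_preserves(2) Cons.IH) simp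
  qed simp
  show "exp_at (concat (foldr insert_factor w [])) x = exp_at w x"
  proof (induction w)
    case (Cons e w)
    obtain k i where e: "e = (k, i)" by (cases e)
    show ?case
      by (simp only: e foldr.simps comp_apply insert_factor_preserves(3) exp_at_simps Cons.IH)
  qed simp
  show "(\<Sum>e\<leftarrow>concat (foldr insert_factor w []). fst e * snd e) = (\<Sum>e\<leftarrow>w. fst e * snd e)"
  proof (induction w)
    case (Cons e w)
    obtain k i where e: "e = (k, i)" by (cases e)
    show ?case
      by (simp only: e foldr.simps comp_apply insert_factor_preserves(4) Cons.IH) simp
  qed simp
qed

lemma foldr_insert_factor_chain:
  "ogs_canonical n w \<Longrightarrow> elementary_chain n (foldr insert_factor w []) \<and>
     descent_exact (foldr insert_factor w [])"
proof (induction w)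
  case Nil
  show ?case by (simp add: elementary_chain_def descent_exact_def)
next
  case (Cons e w)
  let ?G = "foldr insert_factor w []"
  obtain k i where e: "e = (k, i)" by (cases e)
  have w: "ogs_canonical n w" and k: "2 \<le> k" "k \<le> n" and i: "0 < i" "i < k"
    and less: "\<forall>d\<in>set w. k < fst d"
    using Cons.prems unfolding e ogs_canonical_def by auto
  have "k < fst d" if "f \<in> set ?G" "d \<in> set f" for f d
  proof -
    have "d \<in> set (concat ?G)" unfolding set_concat using that by blast
    then have "fst d \<in> fst ` set (concat ?G)" by (rule imageI)
    then have "fst d \<in> fst ` set w" unfolding foldr_insert_factor_preserves(2) .
    then obtain d' where "d' \<in> set w" "fst d = fst d'" by (rule imageE)
    then show ?thesis using less by simp
  qed
  then have "\<forall>f\<in>set ?G. \<forall>d\<in>set f. k < fst d" by (intro ballI)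
  from insert_factor_chain[OF conjunct1[OF Cons.IH[OF w]] conjunct2[OF Cons.IH[OF w]] this k i]
  show ?case by (simp only: e foldr.simps comp_apply)
qed


section \<open>Positions of a generator in a chain\<close>

lemma sum_list_map_nth: "(\<Sum>x\<leftarrow>xs. g x) = (\<Sum>v<length xs. g (xs ! v))"
  by (simp add: sum_list_sum_nth atLeast0LessThan)

lemma exp_at_conv_nth: "exp_at f k = (\<Sum>j | j < length f \<and> fst (f ! j) = k. snd (f ! j))"
proof -
  have "exp_at f k = (\<Sum>e\<leftarrow>f. if fst e = k then snd e else 0)"
    by (induction f) auto
  also have "\<dots> = (\<Sum>j<length f. if fst (f ! j) = k then snd (f ! j) else 0)"
    by (rule sum_list_map_nth)
  also have "\<dots> = (\<Sum>j\<in>{j \<in> {..<length f}. fst (f ! j) = k}. snd (f ! j))"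
    by (rule sum.inter_filter[symmetric]) simp
  finally show ?thesis by simp
qed

lemma exp_at_concat:
  "exp_at (concat F) k =
    (\<Sum>(v, j) \<in> {(v, j). v < length F \<and> j < length (F ! v) \<and> fst (F ! v ! j) = k}. snd (F ! v ! j))"
proof -
  have "exp_at (concat F) k = (\<Sum>f\<leftarrow>F. exp_at f k)"
    by (induction F) auto
  also have "\<dots> = (\<Sum>v<length F. \<Sum>j | j < length (F ! v) \<and> fst (F ! v ! j) = k. snd (F ! v ! j))"
    unfolding sum_list_map_nth exp_at_conv_nth ..
  also have "\<dots> = (\<Sum>(v, j) \<in> Sigma {..<length F}
      (\<lambda>v. {j. j < length (F ! v) \<and> fst (F ! v ! j) = k}). snd (F ! v ! j))"
    by (rule sum.Sigma) auto
  also have "Sigma {..<length F} (\<lambda>v. {j. j < length (F ! v) \<and> fst (F ! v ! j) = k})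
      = {(v, j). v < length F \<and> j < length (F ! v) \<and> fst (F ! v ! j) = k}"
    by auto
  finally show ?thesis .
qed

lemma sorted_fst_nth_eq_iff:
  fixes w :: ogs_expr
  assumes "sorted_wrt (<) (map fst w)" "i < length w" "j < length w"
  shows "fst (w ! i) = fst (w ! j) \<longleftrightarrow> i = j"
proof -
  have "distinct (map fst w)" using assms(1) by (simp only: strict_sorted_iff)
  from nth_eq_iff_index_eq[OF this, of i j] show ?thesis using assms(2,3) by simp
qed

lemma exp_at_nth:
  assumes "sorted_wrt (<) (map fst w)" "j < length w"
  shows "exp_at w (fst (w ! j)) = snd (w ! j)"
proof -
  have "{i. i < length w \<and> fst (w ! i) = fst (w ! j)} = {j}"
    using sorted_fst_nth_eq_iff[OF assms(1) _ assms(2)] assms(2) by auto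
  then show ?thesis by (simp add: exp_at_conv_nth)
qed

text \<open>
  Between the two occurrences all of \<open>fst (last _)\<close>, \<open>exp_sum\<close> and \<open>fst (hd _)\<close> are squeezed to the same
  number; a factor strictly in between would force a strict increase.
\<close>

lemma chain_shared_generator:
  assumes ch: "elementary_chain n F" and v: "v1 < v2" "v2 < length F"
    and j: "j1 < length (F ! v1)" "j2 < length (F ! v2)"
    and eq: "fst (F ! v1 ! j1) = fst (F ! v2 ! j2)"
  shows "v2 = Suc v1 \<and> j1 = length (F ! v1) - 1 \<and> j2 = 0 \<and>
    fst (last (F ! v1)) = exp_sum (F ! v2) \<and> fst (hd (F ! v2)) = exp_sum (F ! v2) \<and>
    exp_sum (F ! v2) = fst (F ! v2 ! j2)"
proof -
  have el: "ogs_elementary n (F ! v)" if "v < length F" for v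
    using ch that by (simp add: elementary_chain_def)
  have le: "fst (last (F ! u)) \<le> exp_sum (F ! v)" if "u < v" "v < length F" for u v
    using ch that by (simp add: elementary_chain_def sorted_wrt_iff_nth_less)
  have el1: "ogs_elementary n (F ! v1)" and el2: "ogs_elementary n (F ! v2)" using el v by auto
  note ne1 = ogs_elementaryD(1)[OF el1] and ne2 = ogs_elementaryD(1)[OF el2]
  have "fst (F ! v1 ! j1) \<le> fst (last (F ! v1))"
    using ogs_elementaryD(5)[OF el1] j(1) by simp
  moreover have "fst (last (F ! v1)) \<le> exp_sum (F ! v2)" using le v by simp
  moreover have "exp_sum (F ! v2) \<le> fst (hd (F ! v2))"
    using ogs_elementaryD(4)[OF el2] ne2 by simp
  moreover have "fst (hd (F ! v2)) \<le> fst (F ! v2 ! j2)"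
    using ogs_elementaryD(6)[OF el2] j(2) by simp
  ultimately have all: "fst (last (F ! v1)) = fst (F ! v1 ! j1)"
    "fst (last (F ! v1)) = exp_sum (F ! v2)" "fst (hd (F ! v2)) = exp_sum (F ! v2)"
    "exp_sum (F ! v2) = fst (F ! v2 ! j2)"
    using eq by linarith+
  have "j1 = length (F ! v1) - 1"
    using sorted_fst_nth_eq_iff[OF ogs_elementaryD(2)[OF el1] j(1), of "length (F ! v1) - 1"]
      all(1) ne1 by (simp add: last_conv_nth)
  moreover have "j2 = 0"
    using sorted_fst_nth_eq_iff[OF ogs_elementaryD(2)[OF el2] j(2), of 0]
      all ne2 by (simp add: hd_conv_nth)
  moreover have "v2 = Suc v1"
  proof (rule ccontr)
    assume "v2 \<noteq> Suc v1"
    then have "Suc v1 < v2" using v by simp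
    then have "fst (last (F ! v1)) \<le> exp_sum (F ! Suc v1)"
      "exp_sum (F ! Suc v1) < fst (last (F ! Suc v1))" "fst (last (F ! Suc v1)) \<le> exp_sum (F ! v2)"
      using le[of v1 "Suc v1"] le[of "Suc v1" v2] exp_sum_less_last[OF el] v by auto
    then show False using all by linarith
  qed
  ultimately show ?thesis using all by blast
qed

text \<open>
  An index in the interior of a factor occurs nowhere else in the chain.
\<close>

lemma chain_total_interior:
  assumes ch: "elementary_chain n F" and v: "v < length F"
    and j: "0 < j" "j < length (F ! v) - 1"
  shows "exp_at (concat F) (fst (F ! v ! j)) = snd (F ! v ! j)"
proof -
  have el: "ogs_elementary n (F ! v)" using ch v by (simp add: elementary_chain_def)
  have jl: "j < length (F ! v)" using j by simp
  have "u = v \<and> i = j" if "u < length F" "i < length (F ! u)" "fst (F ! u ! i) = fst (F ! v ! j)" for u i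
  proof (cases u v rule: linorder_cases)
    case less
    from chain_shared_generator[OF ch less v that(2) jl that(3)] j show ?thesis by simp
  next
    case equal
    then show ?thesis
      using sorted_fst_nth_eq_iff[OF ogs_elementaryD(2)[OF el] _ jl] that by simp
  next
    case greater
    from chain_shared_generator[OF ch greater that(1) jl that(2) that(3)[symmetric]] j
    show ?thesis by simp
  qed
  then have "{(u, i). u < length F \<and> i < length (F ! u) \<and> fst (F ! u ! i) = fst (F ! v ! j)} = {(v, j)}"
    using v jl by auto
  then show ?thesis by (simp add: exp_at_concat)
qed

text \<open>
  Indices are distinct within a factor, so a third occurrence would lie in a third factor, and two factors
  that are not neighbours would share the index.
\<close>

lemma chain_total_shared:
  assumes ch: "elementary_chain n F" and v: "v1 < v2" "v2 < length F"
    and j: "j1 < length (F ! v1)" "j2 < length (F ! v2)"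
    and eq: "fst (F ! v1 ! j1) = fst (F ! v2 ! j2)"
  shows "exp_at (concat F) (fst (F ! v2 ! j2)) = snd (F ! v1 ! j1) + snd (F ! v2 ! j2)"
proof -
  have pos: "v2 = Suc v1" using chain_shared_generator[OF assms] by simp
  have el: "ogs_elementary n (F ! u)" if "u < length F" for u
    using ch that by (simp add: elementary_chain_def)
  have "(u = v1 \<and> i = j1) \<or> (u = v2 \<and> i = j2)"
    if u: "u < length F" "i < length (F ! u)" "fst (F ! u ! i) = fst (F ! v2 ! j2)" for u i
  proof -
    consider "u < v1" | "u = v1" | "u = v2" | "v2 < u" using pos by linarith
    then show ?thesis
    proof cases
      case 1
      then have "u < v2" using v by simp
      from chain_shared_generator[OF ch this v(2) u(2) j(2) u(3)] 1 pos show ?thesis by simp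
    next
      case 2
      then show ?thesis
        using sorted_fst_nth_eq_iff[OF ogs_elementaryD(2)[OF el], of v1 i j1] u v j(1) eq by simp
    next
      case 3
      then show ?thesis
        using sorted_fst_nth_eq_iff[OF ogs_elementaryD(2)[OF el], of v2 i j2] u v j(2) by simp
    next
      case 4
      then have "v1 < u" using v by simp
      from chain_shared_generator[OF ch this u(1) j(1) u(2)] u(3) eq 4 pos show ?thesis by simp
    qed
  qed
  then have "{(u, i). u < length F \<and> i < length (F ! u) \<and> fst (F ! u ! i) = fst (F ! v2 ! j2)}
      = {(v1, j1), (v2, j2)}"
    using v j eq by auto
  then show ?thesis using v by (simp add: exp_at_concat)
qed


section \<open>Lengths\<close>

lemma coxeter_length_simple_refl:
  assumes p: "p permutes {1..n}" and r: "r \<in> {1..n - 1}"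
  shows "int (coxeter_length n (simple_refl r \<cdot> p)) =
    (if r \<in> perm_des n p then int (coxeter_length n p) - 1 else int (coxeter_length n p) + 1)"
proof -
  have "simple_refl r \<cdot> p permutes {1..n}"
    using simple_refl_permutes[OF r] p by (rule permutes_perm_mult)
  note len = coxeter_length_eq_inversions[OF this] coxeter_length_eq_inversions[OF p]
  have "p r \<noteq> p (Suc r)" using injD[OF permutes_inj[OF p], of r "Suc r"] by auto
  then consider "p r < p (Suc r)" | "p (Suc r) < p r" by linarith
  then show ?thesis
  proof cases
    case 1
    then have "r \<notin> perm_des n p" by (simp add: perm_des_def)
    then show ?thesis unfolding len inversions_simple_refl_ascent[OF r 1] by simp
  next
    case 2
    then have "r \<in> perm_des n p" using r by (simp add: perm_des_def)
    then show ?thesis unfolding len inversions_simple_refl_descent[OF r 2, symmetric] by simp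
  qed
qed

lemma coxeter_length_chain_value:
  assumes "elementary_chain n F"
  shows "coxeter_length n (chain_value F) = (\<Sum>f\<leftarrow>F. \<Sum>u<n. elem_code f u)"
proof -
  have "coxeter_length n (chain_value F) = (\<Sum>u<n. chain_code F u)"
    unfolding coxeter_length_eq_inversions[OF chain_value_permutes[OF assms]] inversions_def
    by (rule sum.cong) (simp_all only: inv_code_chain_value[OF assms] lessThan_iff)
  also have "\<dots> = (\<Sum>f\<leftarrow>F. \<Sum>u<n. elem_code f u)"
    by (induction F) (simp_all add: sum.distrib)
  finally show ?thesis .
qed

lemma elementary_chain_singleton: "ogs_elementary n f \<Longrightarrow> elementary_chain n [f]"
  by (simp add: elementary_chain_def)

lemma coxeter_length_elementary:
  assumes "ogs_elementary n f"
  shows "coxeter_length n (ogs_value f) = (\<Sum>u<n. elem_code f u)"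
proof -
  have "chain_value [f] = ogs_value f" by (simp only: list.map perm_prod_simps id_perm_mult)
  then show ?thesis
    using coxeter_length_chain_value[OF elementary_chain_singleton[OF assms]] by simp
qed

lemma perm_des_elementary:
  assumes "ogs_elementary n f"
  shows "perm_des n (ogs_value f) = {exp_sum f}"
proof -
  have "chain_value [f] = ogs_value f" by (simp only: list.map perm_prod_simps id_perm_mult)
  then show ?thesis
    using perm_des_descent_exact[OF elementary_chain_singleton[OF assms]]
    by (simp add: descent_exact_def)
qed

lemma perm_maj_elementary: "ogs_elementary n f \<Longrightarrow> perm_maj n (ogs_value f) = exp_sum f"
  by (simp add: perm_maj_def perm_des_elementary)

theorem theorem3p27:
  fixes n :: nat and \<pi> :: "nat \<Rightarrow> nat" and w :: ogs_expr
  assumes "\<pi> permutes {1..n}"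
    and "ogs_canonical n w" and "w \<noteq> []" and "\<pi> = ogs_value w"
  shows "(\<exists>!F. elementary_factorization n \<pi> F) \<and>
   (\<forall>F. elementary_factorization n \<pi> F \<longrightarrow>
    \<comment> \<open>(1a)\<close>
    (\<forall>v<length F. \<forall>j<length (F ! v). \<exists>!j'. j' < length w \<and> fst (F ! v ! j) = fst (w ! j')) \<and>
    \<comment> \<open>(1b)\<close>
    (\<forall>v j j'. v < length F \<and> 0 < j \<and> j < length (F ! v) - 1 \<and> j' < length w \<and>
        fst (F ! v ! j) = fst (w ! j') \<longrightarrow> snd (F ! v ! j) = snd (w ! j')) \<and>
    \<comment> \<open>(1c)\<close>
    (\<forall>v1 v2 j1 j2. v1 < v2 \<and> v2 < length F \<and> j1 < length (F ! v1) \<and> j2 < length (F ! v2) \<and>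
        fst (F ! v1 ! j1) = fst (F ! v2 ! j2) \<longrightarrow>
        v1 = v2 - 1 \<and> j1 = length (F ! v1) - 1 \<and> j2 = 0 \<and>
        fst (last (F ! (v2 - 1))) = fst (hd (F ! v2)) \<and>
        fst (hd (F ! v2)) = perm_maj n (ogs_value (F ! v2)) \<and>
        (\<exists>j'<length w. perm_maj n (ogs_value (F ! v2)) = fst (w ! j') \<and>
          snd (last (F ! (v2 - 1))) + snd (hd (F ! v2)) = snd (w ! j'))) \<and>
    \<comment> \<open>(2)\<close>
    normal_form n \<pi> = concat (map (\<lambda>f. normal_form n (ogs_value f)) F) \<and>
    \<comment> \<open>(3)\<close>
    (\<forall>r\<in>{1..n - 1}. int (coxeter_length n (simple_refl r \<cdot> \<pi>)) =
        (if \<exists>v<length F. r = exp_sum (F ! v)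
         then int (coxeter_length n \<pi>) - 1 else int (coxeter_length n \<pi>) + 1)) \<and>
    perm_des n \<pi> = (\<Union>v<length F. perm_des n (ogs_value (F ! v))) \<and>
    perm_des n \<pi> = {perm_maj n (ogs_value (F ! v)) | v. v < length F} \<and>
    \<comment> \<open>(4)\<close>
    coxeter_length n \<pi> = (\<Sum>v<length F. coxeter_length n (ogs_value (F ! v))) \<and>
    int (coxeter_length n \<pi>) =
      (\<Sum>v<length F. \<Sum>j<length (F ! v). int (fst (F ! v ! j) * snd (F ! v ! j)))
        - (\<Sum>v<length F. (int (perm_maj n (ogs_value (F ! v))))\<^sup>2) \<and>
    int (coxeter_length n \<pi>) =
      (\<Sum>x<length w. int (fst (w ! x) * snd (w ! x)))
        - (\<Sum>v<length F. (int (perm_maj n (ogs_value (F ! v))))\<^sup>2) \<and>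
    int (coxeter_length n \<pi>) =
      (\<Sum>x<length w. int (fst (w ! x) * snd (w ! x))) - (\<Sum>c\<in>perm_des n \<pi>. (int c)\<^sup>2))"
proof -
  obtain F where ch: "elementary_chain n F" and exact: "descent_exact F"
    and F_value: "\<pi> = chain_value F"
    and F_gens: "fst ` set (concat F) = fst ` set w"
    and F_at: "\<And>k. exp_at (concat F) k = exp_at w k"
    and weight: "(\<Sum>e\<leftarrow>concat F. fst e * snd e) = (\<Sum>e\<leftarrow>w. fst e * snd e)"
  proof
    show "elementary_chain n (foldr insert_factor w [])" "descent_exact (foldr insert_factor w [])"
      using foldr_insert_factor_chain[OF assms(2)] by blast+
    show "\<pi> = chain_value (foldr insert_factor w [])"
      unfolding assms(4) by (rule foldr_insert_factor_preserves(1)[symmetric])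
  qed (rule foldr_insert_factor_preserves)+
  have sorted: "sorted_wrt (<) (map fst w)" using assms(2) by (simp add: ogs_canonical_def)
  have el: "ogs_elementary n (F ! v)" if "v < length F" for v
    using ch that by (simp add: elementary_chain_def)
  have maj: "perm_maj n (ogs_value (F ! v)) = exp_sum (F ! v)" if "v < length F" for v
    by (rule perm_maj_elementary[OF el[OF that]])
  have uniq: "elementary_factorization n \<pi> G \<longleftrightarrow> G = F" for G
    unfolding F_value by (rule descent_exact_elementary_factorization[OF ch exact])
  have des: "perm_des n \<pi> = exp_sum ` set F"
    unfolding F_value by (rule perm_des_descent_exact[OF ch exact])
  have des_iff: "r \<in> perm_des n \<pi> \<longleftrightarrow> (\<exists>v<length F. r = exp_sum (F ! v))" for r
    unfolding des by (auto simp: set_conv_nth)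
  have at_w: "exp_at (concat F) (fst (w ! j')) = snd (w ! j')" if "j' < length w" for j'
    unfolding F_at by (rule exp_at_nth[OF sorted that])
  have in_w: "\<exists>j'<length w. fst (F ! v ! j) = fst (w ! j')" if "v < length F" "j < length (F ! v)" for v j
  proof -
    have "F ! v ! j \<in> set (concat F)" unfolding set_concat using that by (intro UN_I[of "F ! v"]) simp_all
    then have "fst (F ! v ! j) \<in> fst ` set (concat F)" by (rule imageI)
    then have "fst (F ! v ! j) \<in> fst ` set w" unfolding F_gens .
    then obtain e where e: "fst (F ! v ! j) = fst e" "e \<in> set w" by (rule imageE)
    then obtain j' where "j' < length w" "w ! j' = e" unfolding in_set_conv_nth by blast
    with e show ?thesis by auto
  qed
  have length_sum: "coxeter_length n \<pi> = (\<Sum>v<length F. coxeter_length n (ogs_value (F ! v)))"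
    unfolding F_value coxeter_length_chain_value[OF ch] sum_list_map_nth
    by (rule sum.cong) (simp_all only: lessThan_iff coxeter_length_elementary[OF el])
  have weight_F: "(\<Sum>v<length F. \<Sum>j<length (F ! v). fst (F ! v ! j) * snd (F ! v ! j))
      = (\<Sum>e\<leftarrow>concat F. fst e * snd e)"
  proof -
    have "(\<Sum>e\<leftarrow>concat F. fst e * snd e) = (\<Sum>f\<leftarrow>F. \<Sum>e\<leftarrow>f. fst e * snd e)"
      by (induction F) simp_all
    then show ?thesis by (simp only: sum_list_map_nth)
  qed
  have weight_w: "(\<Sum>x<length w. fst (w ! x) * snd (w ! x)) = (\<Sum>e\<leftarrow>concat F. fst e * snd e)"
    unfolding weight by (rule sum_list_map_nth[symmetric])
  have total: "coxeter_length n \<pi> + (\<Sum>v<length F. (perm_maj n (ogs_value (F ! v)))\<^sup>2)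
      = (\<Sum>v<length F. \<Sum>j<length (F ! v). fst (F ! v ! j) * snd (F ! v ! j))"
  proof -
    have "coxeter_length n (ogs_value (F ! v)) + (perm_maj n (ogs_value (F ! v)))\<^sup>2
        = (\<Sum>j<length (F ! v). fst (F ! v ! j) * snd (F ! v ! j))" if "v < length F" for v
      unfolding maj[OF that] coxeter_length_elementary[OF el[OF that]]
        sum_elem_code[OF el[OF that]] by (rule sum_list_map_nth)
    then show ?thesis unfolding length_sum sum.distrib[symmetric] by (intro sum.cong) simp_all
  qed
  have length_F: "int (coxeter_length n \<pi>) =
      (\<Sum>v<length F. \<Sum>j<length (F ! v). int (fst (F ! v ! j) * snd (F ! v ! j)))
        - (\<Sum>v<length F. (int (perm_maj n (ogs_value (F ! v))))\<^sup>2)"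
    using arg_cong[OF total, of int] by simp
  have length_w: "int (coxeter_length n \<pi>) =
      (\<Sum>x<length w. int (fst (w ! x) * snd (w ! x)))
        - (\<Sum>v<length F. (int (perm_maj n (ogs_value (F ! v))))\<^sup>2)"
    using arg_cong[OF total[unfolded weight_F weight_w[symmetric]], of int] by simp
  have squares: "(\<Sum>v<length F. (int (perm_maj n (ogs_value (F ! v))))\<^sup>2) = (\<Sum>c\<in>perm_des n \<pi>. (int c)\<^sup>2)"
  proof -
    have "distinct (map exp_sum F)"
      using exp_sum_increasing[OF ch] by (simp only: strict_sorted_iff)
    then have "(\<Sum>c\<in>perm_des n \<pi>. (int c)\<^sup>2) = (\<Sum>f\<leftarrow>F. (int (exp_sum f))\<^sup>2)"
      unfolding des using sum.distinct_set_conv_list[of "map exp_sum F" "\<lambda>c. (int c)\<^sup>2"]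
      by (simp add: comp_def)
    also have "\<dots> = (\<Sum>v<length F. (int (perm_maj n (ogs_value (F ! v))))\<^sup>2)"
      unfolding sum_list_map_nth by (rule sum.cong) (simp_all add: maj)
    finally show ?thesis ..
  qed
  have unique: "\<exists>!G. elementary_factorization n \<pi> G" unfolding uniq by blast
  have parts_a: "\<forall>v<length F. \<forall>j<length (F ! v). \<exists>!j'. j' < length w \<and> fst (F ! v ! j) = fst (w ! j')"
    using in_w sorted_fst_nth_eq_iff[OF sorted] by metis
  have parts_b: "\<forall>v j j'. v < length F \<and> 0 < j \<and> j < length (F ! v) - 1 \<and> j' < length w \<and>
      fst (F ! v ! j) = fst (w ! j') \<longrightarrow> snd (F ! v ! j) = snd (w ! j')"
    using chain_total_interior[OF ch] at_w by metis
  have parts_c: "\<forall>v1 v2 j1 j2. v1 < v2 \<and> v2 < length F \<and> j1 < length (F ! v1) \<and> j2 < length (F ! v2) \<and>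
      fst (F ! v1 ! j1) = fst (F ! v2 ! j2) \<longrightarrow>
      v1 = v2 - 1 \<and> j1 = length (F ! v1) - 1 \<and> j2 = 0 \<and>
      fst (last (F ! (v2 - 1))) = fst (hd (F ! v2)) \<and>
      fst (hd (F ! v2)) = perm_maj n (ogs_value (F ! v2)) \<and>
      (\<exists>j'<length w. perm_maj n (ogs_value (F ! v2)) = fst (w ! j') \<and>
        snd (last (F ! (v2 - 1))) + snd (hd (F ! v2)) = snd (w ! j'))"
  proof (intro allI impI, elim conjE)
    fix v1 v2 j1 j2
    assume v: "v1 < v2" "v2 < length F" and j: "j1 < length (F ! v1)" "j2 < length (F ! v2)"
      and eq: "fst (F ! v1 ! j1) = fst (F ! v2 ! j2)"
    note pos = chain_shared_generator[OF ch v j eq]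
    obtain j' where j': "j' < length w" "fst (F ! v2 ! j2) = fst (w ! j')"
      using in_w v(2) j(2) by blast
    have ne: "F ! v1 \<noteq> []" "F ! v2 \<noteq> []" using j by auto
    have a: "fst (last (F ! v1)) = exp_sum (F ! v2)" and b: "fst (hd (F ! v2)) = exp_sum (F ! v2)"
      and c: "j1 = length (F ! v1) - 1" "j2 = 0"
      using pos by blast+
    have v1: "v2 - 1 = v1" using pos by simp
    have ends: "last (F ! v1) = F ! v1 ! j1" "hd (F ! v2) = F ! v2 ! j2"
      using pos ne by (simp_all add: last_conv_nth hd_conv_nth)
    have "snd (last (F ! v1)) + snd (hd (F ! v2)) = snd (w ! j')"
      using chain_total_shared[OF ch v j eq] at_w[OF j'(1)] unfolding ends j'(2) by simp
    moreover have "perm_maj n (ogs_value (F ! v2)) = fst (w ! j')"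
      unfolding maj[OF v(2)] j'(2)[symmetric] using pos by blast
    ultimately have "\<exists>j'<length w. perm_maj n (ogs_value (F ! v2)) = fst (w ! j') \<and>
        snd (last (F ! (v2 - 1))) + snd (hd (F ! v2)) = snd (w ! j')"
      unfolding v1 using j'(1) by blast
    then show "v1 = v2 - 1 \<and> j1 = length (F ! v1) - 1 \<and> j2 = 0 \<and>
      fst (last (F ! (v2 - 1))) = fst (hd (F ! v2)) \<and>
      fst (hd (F ! v2)) = perm_maj n (ogs_value (F ! v2)) \<and>
      (\<exists>j'<length w. perm_maj n (ogs_value (F ! v2)) = fst (w ! j') \<and>
        snd (last (F ! (v2 - 1))) + snd (hd (F ! v2)) = snd (w ! j'))"
      unfolding maj[OF v(2)] v1 a b using c by blast
  qed
  have form: "normal_form n \<pi> = concat (map (\<lambda>f. normal_form n (ogs_value f)) F)"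
    unfolding F_value by (rule normal_form_chain_value[OF ch])
  have step: "\<forall>r\<in>{1..n - 1}. int (coxeter_length n (simple_refl r \<cdot> \<pi>)) =
        (if \<exists>v<length F. r = exp_sum (F ! v)
         then int (coxeter_length n \<pi>) - 1 else int (coxeter_length n \<pi>) + 1)"
    unfolding des_iff[symmetric] using coxeter_length_simple_refl[OF assms(1)] by blast
  have des_Un: "perm_des n \<pi> = (\<Union>v<length F. perm_des n (ogs_value (F ! v)))"
    using des_iff by (auto simp: perm_des_elementary[OF el])
  have des_maj: "perm_des n \<pi> = {perm_maj n (ogs_value (F ! v)) | v. v < length F}"
    unfolding set_eq_iff mem_Collect_eq des_iff using maj by metis
  show ?thesis
    unfolding uniq
    using parts_a parts_b parts_c form step des_Un des_maj
      length_sum length_F length_w length_w[unfolded squares]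
    by - (rule conjI, rule unique[unfolded uniq], intro allI impI, hypsubst, (intro conjI; assumption))
qed

end
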